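(* Let $q$ be an odd prime power. Every Zha--Kyureghyan--Wang presemifield of order $q^3$ is isotopic to a Generalized twisted field. Every Zha--Kyureghyan--Wang presemifield of order $q^{3h}$, with $q>3$ and $h>1$ odd, is not isotopic to any presemifield of the following known families: Dickson semifields, Generalized twisted fields, Ganley semifields, Cohen--Ganley semifields, Coulter--Matthews/Ding--Yuan presemifields, the Penttila--Williams/Bader--Lunardon--Pinneri semifield, the Coulter--Henderson--Kosick presemifield, Bierbrauer presemifields, Budaghyan--Helleseth presemifields, $P(q,\ell)$ semifields.
   Context: A finite semifield $(S,+,\star)$ satisfies all axioms of a skewfield except possibly associativity of multiplication; a presemifield satisfies all axioms of a semifield except possibly existence of a multiplicative identity. Presemifields $(S,+,\star)$, $(S',+,\star')$ of characteristic $p$ are isotopic if there are invertible $\mathbb{F}_p$-linear maps $g_1,g_2,g_3:S\to S'$ with $g_1(x)\star' g_2(y)=g_3(x\star y)$ for all $x,y$. In each family below, parameters such as $q$ are independent of those of the other families. Zha--Kyureghyan--Wang presemifields of order $q^{3h}$: $(\mathbb{F}_{q^{3h}},+,\star)$, $q$ an odd prime power, $h$ odd, $x\star y=y^{q^n}x+yx^{q^n}-v(y^{q^{h+n}}x^{q^{2h}}+y^{q^{2h}}x^{q^{h+n}})$, where $0<n<3h$, $\gcd(h,n)=1$, $v=u^{q^h-1}$, $u$ a primitive element of $\mathbb{F}_{q^{3h}}$, and either $h+n\equiv0\pmod3$ or $q\equiv1\pmod3$. Dickson semifields: $(\mathbb{F}_{q^k}\times\mathbb{F}_{q^k},+,\star)$,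 $q$ an odd prime power, $k>1$, $(a,b)\star(c,d)=(ac+jb^\sigma d^\sigma,ad+bc)$, $j$ a nonsquare in $\mathbb{F}_{q^k}$, $\sigma\neq\mathrm{id}$ an $\mathbb{F}_q$-automorphism of $\mathbb{F}_{q^k}$. (Commutative) Generalized twisted fields: $(\mathbb{F}_{q^t},+,\star)$, $q$ an odd prime power, $t>1$ odd, $x\star y=x^\alpha y+xy^\alpha$, where $\alpha:x\mapsto x^{q^n}$ is an automorphism of $\mathbb{F}_{q^t}$ with fixed field $\mathbb{F}_q$ and $\frac{t}{\gcd(t,n)}$ odd. Ganley semifields: $(\mathbb{F}_{3^r}\times\mathbb{F}_{3^r},+,\star)$, $r\ge3$ odd, $(a,b)\star(c,d)=(ac-b^9d-bd^9,ad+bc+b^3d^3)$. Cohen--Ganley semifields: $(\mathbb{F}_{3^s}\times\mathbb{F}_{3^s},+,\star)$, $s\ge3$, $(a,b)\star(c,d)=(ac+jbd+j^3(bd)^9,ad+bc+j(bd)^3)$, $j$ a nonsquare in $\mathbb{F}_{3^s}$. Coulter--Matthews/Ding--Yuan presemifields: $(\mathbb{F}_{3^e},+,\star)$, $e\ge3$ odd, $x\star y=x^9y+xy^9\pm2x^3y^3-2xy$. Penttila--Williams/Bader--Lunardon--Pinneri semifield: $(\mathbb{F}_{3^5}\times\mathbb{F}_{3^5},+,\star)$, $(a,b)\star(c,d)=(ac+(bd)^9,ad+bc+(bd)^{27})$. Coulter--Henderson--Kosick presemifield: $(\mathbb{F}_{3^8},+,\star)$, $x\star y=xy+L(xy^9+x^9y-xy-x^9y^9)+x^{243}y^3+x^{81}y-x^9y+x^3y^{243}+xy^{81}-xy^9$,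 with $L(x)=x^{3^5}+x^{3^2}$. Bierbrauer presemifields: $(\mathbb{F}_{q^{4m}},+,\star)$, $q$ an odd prime power, $x\star y=y^{q^n}x+yx^{q^n}-v(y^{q^{m+n}}x^{q^{3m}}+y^{q^{3m}}x^{q^{m+n}})$, where $v=u^{q^m-1}$, $u$ a primitive element of $\mathbb{F}_{q^{4m}}$, $0<n<4m$, $\gcd(m,n)=1$, $\frac{2m}{\gcd(2m,n)}$ odd, $q^m\equiv q^n\equiv1\pmod4$. Budaghyan--Helleseth presemifields: $(\mathbb{F}_{q^{2\ell}},+,\star)$, $q$ an odd prime power, $\ell>1$, $x\star y=xy^{q^\ell}+x^{q^\ell}y+[\beta(xy^{q^d}+x^{q^d}y)+\beta^{q^\ell}(xy^{q^d}+x^{q^d}y)^{q^\ell}]\omega$, where $0<d<2\ell$, $\gcd(\ell,d)=1$, $\omega\in\mathbb{F}_{q^{2\ell}}\setminus\mathbb{F}_{q^\ell}$ with $\omega^{q^\ell}=-\omega$, $\ell+d$ odd, and $\beta$ a nonsquare in $\mathbb{F}_{q^{2\ell}}$. $P(q,\ell)$ semifields: $(\mathbb{F}_{q^{2\ell}},+,* )$, $q$ an odd prime power, $\ell=2k+1>1$ odd, $x*y=\frac12(xy+x^{q^\ell}y^{q^\ell})+\frac14G(xy^{q^2}+x^{q^2}y)$, where $G(x)=\sum_{i=0}^{k}(-1)^i(x-x^{q^\ell})^{q^{2i}}+\sum_{j=0}^{k-1}(-1)^{k+j}(x-x^{q^\ell})^{q^{2j+1}}$. *)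

theory Defs
  imports
    "HOL-Number_Theory.Number_Theory"
    "HOL-Library.Cardinality"
    "HOL-Library.Product_Plus"
begin

section \<open>Presemifields and isotopisms\<close>

text \<open>
  The additive group is always that of the underlying finite type (a finite field or
  a product of two copies of one, with componentwise addition); a presemifield on it is
  given by its multiplication.
\<close>

definition presemifield :: "('s::{finite, ab_group_add} \<Rightarrow> 's \<Rightarrow> 's) \<Rightarrow> bool" where
  "presemifield star \<longleftrightarrow>
     (\<exists>x::'s. x \<noteq> 0) \<and>
     (\<forall>x y z. star x (y + z) = star x y + star x z) \<and>
     (\<forall>x y z. star (x + y) z = star x z + star y z) \<and>
     (\<forall>x y. star x y = 0 \<longrightarrow> x = 0 \<or> y = 0)"

definition nat_scale :: "nat \<Rightarrow> 's::comm_monoid_add \<Rightarrow> 's" where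
  "nat_scale n x = (\<Sum>i<n. x)"

definition has_characteristic :: "'s::ab_group_add itself \<Rightarrow> nat \<Rightarrow> bool" where
  "has_characteristic T p \<longleftrightarrow> prime p \<and> (\<exists>x::'s. x \<noteq> 0) \<and> (\<forall>x::'s. nat_scale p x = 0)"

text \<open>
  On a group of exponent \<open>p\<close>, the residue class of \<open>n\<close> in \<open>\<int>/p\<int> = F\<^sub>p\<close> acts
  by \<open>n\<close>-fold addition.
\<close>

definition prime_field_linear :: "nat \<Rightarrow> ('s::ab_group_add \<Rightarrow> 't::ab_group_add) \<Rightarrow> bool" where
  "prime_field_linear p g \<longleftrightarrow>
     (\<forall>x y. g (x + y) = g x + g y) \<and> (\<forall>n<p. \<forall>x. g (nat_scale n x) = nat_scale n (g x))"

text \<open>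
  The relation makes sense for arbitrary multiplications and is not guarded by
  \<open>presemifield\<close>, so that the negation of isotopy can never hold merely because a
  multiplication fails to be a presemifield.  It preserves being a presemifield, see
  \<open>isotopic_presemifield\<close> below.
\<close>

definition isotopic ::
  "('s::{finite, ab_group_add} \<Rightarrow> 's \<Rightarrow> 's) \<Rightarrow> ('t::{finite, ab_group_add} \<Rightarrow> 't \<Rightarrow> 't) \<Rightarrow> bool"
where
  "isotopic star star' \<longleftrightarrow>
     (\<exists>p. has_characteristic TYPE('s) p \<and> has_characteristic TYPE('t) p \<and>
        (\<exists>g1 g2 g3 :: 's \<Rightarrow> 't.
           prime_field_linear p g1 \<and> bij g1 \<and>
           prime_field_linear p g2 \<and> bij g2 \<and>
           prime_field_linear p g3 \<and> bij g3 \<and>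
           (\<forall>x y. star' (g1 x) (g2 y) = g3 (star x y))))"

lemma isotopic_presemifield:
  assumes "presemifield star" "isotopic star star'"
  shows "presemifield star'"
proof -
  obtain p g1 g2 g3 where
    char: "has_characteristic TYPE('b) p"
    and lin: "prime_field_linear p g1" "prime_field_linear p g2" "prime_field_linear p g3"
    and bij: "bij g1" "bij g2" "bij g3"
    and iso: "\<And>x y. star' (g1 x) (g2 y) = g3 (star x y)"
    using assms(2) unfolding isotopic_def by blast
  have add: "g1 (x + y) = g1 x + g1 y" "g2 (x + y) = g2 x + g2 y" "g3 (x + y) = g3 x + g3 y"
    for x y using lin by (auto simp: prime_field_linear_def)
  have zero: "g1 0 = 0" "g2 0 = 0" "g3 0 = 0"
    using add[of 0 0] by auto
  have surj: "\<exists>a. x = g1 a" "\<exists>a. x = g2 a" for x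
    using bij by (meson bij_pointE)+
  have ps: "star x (y + z) = star x y + star x z" "star (x + y) z = star x z + star y z"
    "star x y = 0 \<Longrightarrow> x = 0 \<or> y = 0" for x y z
    using assms(1) by (auto simp: presemifield_def)
  have g30: "g3 x = 0 \<Longrightarrow> x = 0" for x
    using bij(3) zero(3) by (metis bij_def injD)
  show ?thesis
    unfolding presemifield_def
  proof (intro conjI allI impI)
    show "\<exists>x::'b. x \<noteq> 0" using char by (simp add: has_characteristic_def)
  next
    fix x y z
    obtain a b c where "x = g1 a" "y = g2 b" "z = g2 c" using surj by meson
    then show "star' x (y + z) = star' x y + star' x z"
      by (simp add: iso ps add flip: add(2))
  next
    fix x y z
    obtain a b c where "x = g1 a" "y = g1 b" "z = g2 c" using surj by meson
    then show "star' (x + y) z = star' x z + star' y z"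
      by (simp add: iso ps add flip: add(1))
  next
    fix x y assume "star' x y = 0"
    moreover obtain a b where "x = g1 a" "y = g2 b" using surj by meson
    ultimately show "x = 0 \<or> y = 0" using iso g30 ps(3) zero by metis
  qed
qed

section \<open>Finite field vocabulary\<close>

definition odd_prime_power :: "nat \<Rightarrow> bool" where
  "odd_prime_power q \<longleftrightarrow> primepow q \<and> odd q"

definition primitive_element :: "'a::{field, finite} \<Rightarrow> bool" where
  "primitive_element u \<longleftrightarrow> range (\<lambda>k::nat. u ^ k) = UNIV - {0}"

definition nonsquare :: "'a::{field, finite} \<Rightarrow> bool" where
  "nonsquare j \<longleftrightarrow> \<not> (\<exists>y. j = y ^ 2)"

text \<open>The subfield \<open>F\<^sub>r\<close>, whenever \<open>'a\<close> is an extension of a field of order \<open>r\<close>.\<close>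

definition subfield_of_order :: "nat \<Rightarrow> 'a::{field, finite} set" where
  "subfield_of_order r = {x. x ^ r = x}"

definition field_automorphism_over :: "'a::{field, finite} set \<Rightarrow> ('a \<Rightarrow> 'a) \<Rightarrow> bool" where
  "field_automorphism_over K s \<longleftrightarrow>
     bij s \<and> s 1 = 1 \<and> (\<forall>x y. s (x + y) = s x + s y) \<and> (\<forall>x y. s (x * y) = s x * s y) \<and>
     (\<forall>x\<in>K. s x = x)"

section \<open>The known families\<close>

text \<open>Order \<open>q ^ (3 * h)\<close>.\<close>

definition zha_kyureghyan_wang ::
  "nat \<Rightarrow> nat \<Rightarrow> ('a::{field, finite} \<Rightarrow> 'a \<Rightarrow> 'a) \<Rightarrow> bool" where
  "zha_kyureghyan_wang q h star \<longleftrightarrow>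
     odd_prime_power q \<and> odd h \<and> CARD('a) = q ^ (3 * h) \<and>
     (\<exists>n u v.
        0 < n \<and> n < 3 * h \<and> coprime h n \<and>
        primitive_element u \<and> v = u ^ (q ^ h - 1) \<and>
        ([h + n = 0] (mod 3) \<or> [q = 1] (mod 3)) \<and>
        star = (\<lambda>x y. y ^ (q ^ n) * x + y * x ^ (q ^ n)
                  - v * (y ^ (q ^ (h + n)) * x ^ (q ^ (2 * h))
                         + y ^ (q ^ (2 * h)) * x ^ (q ^ (h + n)))))"

definition dickson :: "('a::{field, finite} \<times> 'a \<Rightarrow> 'a \<times> 'a \<Rightarrow> 'a \<times> 'a) \<Rightarrow> bool" where
  "dickson star \<longleftrightarrow>
     (\<exists>q k j s.
        odd_prime_power q \<and> k > 1 \<and> CARD('a) = q ^ k \<and>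
        nonsquare j \<and>
        field_automorphism_over (subfield_of_order q) s \<and> s \<noteq> id \<and>
        star = (\<lambda>(a, b) (c, d). (a * c + j * s b * s d, a * d + b * c)))"

definition generalized_twisted_field :: "('a::{field, finite} \<Rightarrow> 'a \<Rightarrow> 'a) \<Rightarrow> bool" where
  "generalized_twisted_field star \<longleftrightarrow>
     (\<exists>q t n \<alpha>.
        odd_prime_power q \<and> t > 1 \<and> odd t \<and> CARD('a) = q ^ t \<and>
        \<alpha> = (\<lambda>x. x ^ (q ^ n)) \<and> {x. \<alpha> x = x} = subfield_of_order q \<and>
        odd (t div gcd t n) \<and>
        star = (\<lambda>x y. \<alpha> x * y + x * \<alpha> y))"

definition ganley :: "('a::{field, finite} \<times> 'a \<Rightarrow> 'a \<times> 'a \<Rightarrow> 'a \<times> 'a) \<Rightarrow> bool" where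
  "ganley star \<longleftrightarrow>
     (\<exists>r\<ge>3. odd r \<and> CARD('a) = 3 ^ r \<and>
        star = (\<lambda>(a, b) (c, d).
                  (a * c - b ^ 9 * d - b * d ^ 9, a * d + b * c + b ^ 3 * d ^ 3)))"

definition cohen_ganley :: "('a::{field, finite} \<times> 'a \<Rightarrow> 'a \<times> 'a \<Rightarrow> 'a \<times> 'a) \<Rightarrow> bool" where
  "cohen_ganley star \<longleftrightarrow>
     (\<exists>s\<ge>3. \<exists>j. CARD('a) = 3 ^ s \<and> nonsquare j \<and>
        star = (\<lambda>(a, b) (c, d).
                  (a * c + j * b * d + j ^ 3 * (b * d) ^ 9, a * d + b * c + j * (b * d) ^ 3)))"

definition coulter_matthews_ding_yuan :: "('a::{field, finite} \<Rightarrow> 'a \<Rightarrow> 'a) \<Rightarrow> bool" where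
  "coulter_matthews_ding_yuan star \<longleftrightarrow>
     (\<exists>e\<ge>3. odd e \<and> CARD('a) = 3 ^ e \<and>
        (star = (\<lambda>x y. x ^ 9 * y + x * y ^ 9 + 2 * x ^ 3 * y ^ 3 - 2 * x * y) \<or>
         star = (\<lambda>x y. x ^ 9 * y + x * y ^ 9 - 2 * x ^ 3 * y ^ 3 - 2 * x * y)))"

definition penttila_williams_bader_lunardon_pinneri ::
  "('a::{field, finite} \<times> 'a \<Rightarrow> 'a \<times> 'a \<Rightarrow> 'a \<times> 'a) \<Rightarrow> bool" where
  "penttila_williams_bader_lunardon_pinneri star \<longleftrightarrow>
     CARD('a) = 3 ^ 5 \<and>
     star = (\<lambda>(a, b) (c, d). (a * c + (b * d) ^ 9, a * d + b * c + (b * d) ^ 27))"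

definition coulter_henderson_kosick :: "('a::{field, finite} \<Rightarrow> 'a \<Rightarrow> 'a) \<Rightarrow> bool" where
  "coulter_henderson_kosick star \<longleftrightarrow>
     CARD('a) = 3 ^ 8 \<and>
     (let L = (\<lambda>x. x ^ (3 ^ 5) + x ^ (3 ^ 2)) in
      star = (\<lambda>x y. x * y + L (x * y ^ 9 + x ^ 9 * y - x * y - x ^ 9 * y ^ 9)
                + x ^ 243 * y ^ 3 + x ^ 81 * y - x ^ 9 * y
                + x ^ 3 * y ^ 243 + x * y ^ 81 - x * y ^ 9))"

definition bierbrauer :: "('a::{field, finite} \<Rightarrow> 'a \<Rightarrow> 'a) \<Rightarrow> bool" where
  "bierbrauer star \<longleftrightarrow>
     (\<exists>q m n u v.
        odd_prime_power q \<and> CARD('a) = q ^ (4 * m) \<and>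
        primitive_element u \<and> v = u ^ (q ^ m - 1) \<and>
        0 < n \<and> n < 4 * m \<and> coprime m n \<and> odd ((2 * m) div gcd (2 * m) n) \<and>
        [q ^ m = 1] (mod 4) \<and> [q ^ n = 1] (mod 4) \<and>
        star = (\<lambda>x y. y ^ (q ^ n) * x + y * x ^ (q ^ n)
                  - v * (y ^ (q ^ (m + n)) * x ^ (q ^ (3 * m))
                         + y ^ (q ^ (3 * m)) * x ^ (q ^ (m + n)))))"

definition budaghyan_helleseth :: "('a::{field, finite} \<Rightarrow> 'a \<Rightarrow> 'a) \<Rightarrow> bool" where
  "budaghyan_helleseth star \<longleftrightarrow>
     (\<exists>q l d \<omega> \<beta>.
        odd_prime_power q \<and> l > 1 \<and> CARD('a) = q ^ (2 * l) \<and>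
        0 < d \<and> d < 2 * l \<and> coprime l d \<and> odd (l + d) \<and>
        \<omega> \<notin> subfield_of_order (q ^ l) \<and> \<omega> ^ (q ^ l) = - \<omega> \<and>
        nonsquare \<beta> \<and>
        star = (\<lambda>x y. x * y ^ (q ^ l) + x ^ (q ^ l) * y
                  + (\<beta> * (x * y ^ (q ^ d) + x ^ (q ^ d) * y)
                     + \<beta> ^ (q ^ l) * (x * y ^ (q ^ d) + x ^ (q ^ d) * y) ^ (q ^ l)) * \<omega>))"

definition P_semifield :: "('a::{field, finite} \<Rightarrow> 'a \<Rightarrow> 'a) \<Rightarrow> bool" where
  "P_semifield star \<longleftrightarrow>
     (\<exists>q l k.
        odd_prime_power q \<and> l = 2 * k + 1 \<and> l > 1 \<and> CARD('a) = q ^ (2 * l) \<and>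
        (let G = (\<lambda>x. (\<Sum>i=0..k. (-1) ^ i * (x - x ^ (q ^ l)) ^ (q ^ (2 * i)))
                     + (\<Sum>j=0..k-1. (-1) ^ (k + j) * (x - x ^ (q ^ l)) ^ (q ^ (2 * j + 1)))) in
         star = (\<lambda>x y. (1 / 2) * (x * y + x ^ (q ^ l) * y ^ (q ^ l))
                   + (1 / 4) * G (x * y ^ (q ^ 2) + x ^ (q ^ 2) * y))))"

end

theory Submission
  imports Defs "HOL-Computational_Algebra.Polynomial"
begin

text \<open>
  Every additive map of a field with \<open>p ^ N\<close> elements is a linearised polynomial, that is, a
  linear combination of the Frobenius powers \<open>x ^ (p ^ e)\<close> with \<open>e < N\<close>, in a unique way.  A
  biadditive map therefore has a coefficient matrix with respect to the monomials
  \<open>x ^ (p ^ i) * y ^ (p ^ j)\<close>, and the rank of this matrix is the least number of products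
  \<open>\<phi> x * \<psi> y\<close> whose sum is the given map.  A component of a multiplication is its composition
  with a nonzero additive map into a finite field.  Isotopic multiplications have components of the
  same ranks: the three isotopism maps only reparametrise \<open>x\<close>, \<open>y\<close> and the additive map
  (\<open>isotopic_component_of_rank\<close>).

  A Zha--Kyureghyan--Wang presemifield of order \<open>q ^ (3 * h)\<close> is given by four monomials.  For
  \<open>h > 1\<close> their exponents are so independent modulo \<open>3 * h\<close> that the coefficient matrix of each
  component into the field of that order contains a nonsingular diagonal block of size four, so none of
  them has rank three or less (\<open>sparse_biadditive_rank\<close>, \<open>zkw_component_rank\<close>).  Most of the other families do
  have such a component.  Generalized twisted fields have two monomials, and the
  Coulter--Matthews/Ding--Yuan multiplications can be written with three products.  For the
  multiplications on pairs one takes the second coordinate \<open>a d + b c + \<dots>\<close>.  For the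
  Budaghyan--Helleseth and \<open>P(q, l)\<close> multiplications one takes the trace to the subfield of
  index two, which kills the complicated part and leaves two products.  The two presemifields
  may live over different fields; an embedding of one field into the other
  (\<open>finite_field_embedding\<close>) allows the ranks to be compared.

  The Coulter--Henderson--Kosick presemifield has order \<open>3 ^ 8\<close>, and 8 is not a multiple of 3.
  A Bierbrauer presemifield of order \<open>r ^ (4 * m)\<close> has the same shape with four monomials.  For
  \<open>m = 1\<close> two of them coincide, and three products suffice.  For \<open>m > 1\<close> the middle nuclei decide: both
  families are instances of one computation (\<open>four_term_middle_nucleus\<close>), which gives order
  \<open>q\<close> for the first family and \<open>r\<^sup>2\<close> for the second.  An isotopism would give \<open>q = r\<^sup>2\<close> and
  \<open>q ^ (3 * h) = r ^ (4 * m)\<close>, hence \<open>3 * h = 2 * m\<close> with \<open>h\<close> odd.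

  In order \<open>q ^ 3\<close> the isotopism is explicit.  For \<open>n = 2\<close> the four monomials collapse to
  \<open>(1 - v) * (x ^ q\<^sup>2 * y + x * y ^ q\<^sup>2)\<close>.  For \<open>n = 1\<close> one has \<open>q \<equiv> 1\<close> modulo 3, a scaling of the
  variables turns \<open>v\<close> into a primitive cube root of unity \<open>\<zeta>\<close> of the field with \<open>q\<close> elements, and
  a circulant substitution with entries \<open>1, \<zeta>, \<zeta>\<close> gives the twisted field multiplication.
\<close>

section \<open>Finite fields and Frobenius powers\<close>

text \<open>
  Multiplication by a nonzero \<open>x\<close> permutes the nonzero elements, so it preserves their
  product.
\<close>

lemma power_card_eq_self:
  fixes x :: "'a :: {field, finite}"
  shows "x ^ CARD('a) = x"
proof (cases "x = 0")
  case False
  have "x * (\<Prod>y\<in>UNIV-{0}. x * y) = x * x ^ (CARD('a) - 1) * \<Prod>(UNIV-{0})"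
    by (simp add: prod.distrib mult_ac)
  also have "x * x ^ (CARD('a) - 1) = x ^ Suc (CARD('a) - 1)"
    by (subst power_Suc) auto
  also have "Suc (CARD('a) - 1) = CARD('a)"
    using finite_UNIV_card_ge_0[where ?'a = 'a] by simp
  also have "(\<Prod>y\<in>UNIV-{0}. x * y) = (\<Prod>y\<in>UNIV-{0}. y)"
    by (rule prod.reindex_bij_witness[of _ "\<lambda>y. y / x" "\<lambda>y. x * y"]) (use False in auto)
  finally show ?thesis
    by simp
qed (use finite_UNIV_card_ge_0[where ?'a = 'a] in auto)

lemma power_card_minus_one:
  fixes x :: "'a :: {field, finite}"
  assumes "x \<noteq> 0"
  shows "x ^ (CARD('a) - 1) = 1"
proof -
  have "x * x ^ (CARD('a) - 1) = x ^ CARD('a)"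
    using finite_UNIV_card_ge_0[where ?'a = 'a] by (simp flip: power_Suc)
  then show ?thesis using power_card_eq_self[of x] assms by simp
qed

lemma card_field_ge_2: "CARD('a :: {field, finite}) \<ge> 2"
  using card_mono[of "UNIV :: 'a set" "{0, 1}"] by auto

text \<open>
  The multiplicative group of a finite field, viewed as a ring record, is cyclic.
\<close>

lemma ex_primitive_element: "\<exists>u :: 'a :: {field, finite}. primitive_element u"
proof -
  define R where "R = (\<lparr>carrier = UNIV, mult = (*), one = 1, zero = 0, add = (+)\<rparr> :: 'a ring)"
  have inv: "\<exists>y. y * x = 1 \<and> x * y = 1" if "x \<noteq> 0" for x :: 'a
    using that by (intro exI[of _ "inverse x"]) auto
  have neg: "\<exists>y. y + x = 0 \<and> x + y = 0" for x :: 'a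
    by (intro exI[of _ "- x"]) auto
  have "cring R"
    by (rule cringI, rule abelian_groupI, unfold R_def)
       (use neg in \<open>auto simp: algebra_simps intro!: comm_monoidI\<close>)
  then interpret cring R .
  have "Units R = carrier R - {\<zero>\<^bsub>R\<^esub>}"
    using inv by (auto simp: R_def Units_def)
  then interpret R: Ring.field R by (intro cring_fieldI)
  have pow: "x [^]\<^bsub>R\<^esub> k = x ^ k" for x and k :: nat
    by (induction k) (auto simp: R_def mult.commute)
  have "finite (carrier R)" by (simp add: R_def)
  from R.finite_field_mult_group_has_gen[OF this] obtain u
    where "carrier (mult_of R) = {u [^]\<^bsub>R\<^esub> i |i::nat. i \<in> UNIV}" by auto
  moreover have "carrier (mult_of R) = UNIV - {0}" by (simp add: R_def)
  moreover have "{u [^]\<^bsub>R\<^esub> i |i::nat. i \<in> UNIV} = range (\<lambda>i. u ^ i)" by (auto simp: pow)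
  ultimately show ?thesis unfolding primitive_element_def by metis
qed

lemma primitive_element_nonzero: "primitive_element u \<Longrightarrow> u \<noteq> 0"
  unfolding primitive_element_def by (metis DiffD2 power_one_right rangeI singletonI)

lemma primitive_element_power_ne_1:
  fixes u :: "'a::{field, finite}"
  assumes "primitive_element u" "0 < k" "k < CARD('a) - 1"
  shows "u ^ k \<noteq> 1"
proof
  assume k: "u ^ k = 1"
  have "u ^ i = u ^ (i mod k)" for i
    using k by (metis mult_div_mod_eq power_add power_mult power_one mult_1)
  then have sub: "range (\<lambda>i. u ^ i) \<subseteq> (\<lambda>i. u ^ i) ` {..<k}"
  proof safe
    fix i
    have "i mod k < k" using assms(2) by simp
    then show "u ^ i \<in> (\<lambda>i. u ^ i) ` {..<k}"
      using \<open>\<And>i. u ^ i = u ^ (i mod k)\<close>[of i] by blast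
  qed
  have "card (range (\<lambda>i::nat. u ^ i)) \<le> k"
    using card_mono[OF _ sub] card_image_le[of "{..<k}" "\<lambda>i. u ^ i"] by simp
  then show False using assms by (simp add: primitive_element_def card_Diff_singleton)
qed

text \<open>
  A field with \<open>p ^ N\<close> elements, where \<open>p\<close> is prime.  The power map \<open>x \<mapsto> x ^ (p ^ i)\<close> is additive,
  injective, and depends on \<open>i\<close> modulo \<open>N\<close> only.
\<close>

locale field_of_order =
  fixes F :: "'a::{field, finite} itself" and p N :: nat
  assumes prime: "prime p" and card: "CARD('a) = p ^ N"
begin

lemma CHAR_eq: "CHAR('a) = p"
proof -
  have "prime CHAR('a)" by (simp add: prime_CHAR_semidom finite_imp_CHAR_pos)
  moreover have "CHAR('a) dvd p ^ N" using CHAR_dvd_CARD[where 'a='a] card by simp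
  ultimately show ?thesis using prime prime_dvd_power primes_dvd_imp_eq by blast
qed

lemma N_pos: "N > 0"
  using card_field_ge_2[where 'a='a] card by (cases N) auto

lemma p_gt_1: "p > 1" using prime prime_gt_1_nat by blast

lemma frob_add: "(x + y :: 'a) ^ (p ^ i) = x ^ (p ^ i) + y ^ (p ^ i)"
  by (rule freshmans_dream') (use CHAR_eq prime in auto)

lemma frob_sum: "(sum f A :: 'a) ^ (p ^ i) = (\<Sum>x\<in>A. f x ^ (p ^ i))"
  by (rule freshmans_dream_sum') (use CHAR_eq prime in auto)

lemma frob_minus: "(- x :: 'a) ^ (p ^ i) = - (x ^ (p ^ i))"
  using frob_add[of x "- x" i] p_gt_1 by (simp add: eq_neg_iff_add_eq_0 add.commute zero_power)

lemma frob_diff: "(x - y :: 'a) ^ (p ^ i) = x ^ (p ^ i) - y ^ (p ^ i)"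
  using frob_add[of x "- y" i] by (simp add: frob_minus)

lemma frob_eq_0_iff: "(x :: 'a) ^ (p ^ i) = 0 \<longleftrightarrow> x = 0"
  using p_gt_1 by simp

lemma frob_inj: "(x :: 'a) ^ (p ^ i) = y ^ (p ^ i) \<longleftrightarrow> x = y"
  using frob_eq_0_iff[of "x - y" i] by (auto simp: frob_diff)

lemma frob_periodic: "(x :: 'a) ^ (p ^ (i + N * k)) = x ^ (p ^ i)"
proof (induction k)
  case (Suc k)
  have "x ^ (p ^ (i + N * Suc k)) = (x ^ (p ^ (i + N * k))) ^ CARD('a)"
    by (simp add: card power_add flip: power_mult) (simp add: mult_ac)
  then show ?case using Suc by (simp add: power_card_eq_self)
qed auto

lemma frob_cong:
  assumes "[i = j] (mod N)" shows "(x :: 'a) ^ (p ^ i) = x ^ (p ^ j)"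
proof -
  have "x ^ (p ^ i) = x ^ (p ^ (i mod N))" for i
    using frob_periodic[of x "i mod N" "i div N"] by simp
  then show ?thesis using assms by (metis cong_def)
qed

text \<open>
  If two Frobenius powers agreed, then, cancelling the smaller one, all \<open>p ^ N\<close> elements would
  be roots of \<open>X ^ (p ^ d) - X\<close> for some \<open>0 < d < N\<close>.
\<close>

lemma frob_distinct:
  assumes "\<not> [i = j] (mod N)"
  shows "\<exists>x :: 'a. x \<noteq> 0 \<and> x ^ (p ^ i) \<noteq> x ^ (p ^ j)"
proof -
  have *: "\<exists>x :: 'a. x ^ (p ^ i) \<noteq> x ^ (p ^ j)" if "i < j" "j < N" for i j
  proof (rule ccontr)
    assume "\<not> ?thesis"
    then have eq: "x ^ (p ^ i) = x ^ (p ^ j)" for x :: 'a by blast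
    define d where "d = j - i"
    have d: "0 < d" "d < N" "j = d + i" using that by (auto simp: d_def)
    have fixed: "x ^ (p ^ d) = x" for x :: 'a
      using eq[of x] frob_inj[of "x ^ (p ^ d)" i x] d by (simp add: power_add flip: power_mult)
    define P where "P = (monom 1 (p ^ d) - monom 1 1 :: 'a poly)"
    have pd: "p ^ d > 1" using one_less_power[OF p_gt_1 d(1)] .
    have "degree (monom (1::'a) 1) < p ^ d" using pd by (simp add: degree_monom_eq)
    then have deg: "degree P = p ^ d"
      unfolding P_def by (subst diff_conv_add_uminus, subst degree_add_eq_left) (auto simp: degree_monom_eq)
    then have "P \<noteq> 0" using pd by (metis degree_0 not_less_zero)
    then have "card {x. poly P x = 0} \<le> p ^ d"
      using card_poly_roots_bound[of P] deg by simp
    moreover have "{x. poly P x = 0} = UNIV" by (auto simp: P_def poly_monom fixed)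
    ultimately have "p ^ N \<le> p ^ d" using card by simp
    from power_le_imp_le_exp[OF p_gt_1 this] d show False by simp
  qed
  have lt: "i mod N < N" "j mod N < N" using N_pos by auto
  have ne: "i mod N \<noteq> j mod N" using assms by (simp add: cong_def)
  have "\<exists>x :: 'a. x ^ (p ^ (i mod N)) \<noteq> x ^ (p ^ (j mod N))"
    using *[of "i mod N" "j mod N"] *[of "j mod N" "i mod N"] lt ne by (metis linorder_neqE_nat)
  then obtain x :: 'a where x: "x ^ (p ^ (i mod N)) \<noteq> x ^ (p ^ (j mod N))" by blast
  then have "x ^ (p ^ i) \<noteq> x ^ (p ^ j)"
    using frob_cong[of i "i mod N" x] frob_cong[of j "j mod N" x] by (simp add: cong_def)
  moreover from this have "x \<noteq> 0" using p_gt_1 by (auto simp: zero_power)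
  ultimately show ?thesis by blast
qed

lemma of_nat_card_minus_one: "of_nat (CARD('a) - 1) = (- 1 :: 'a)"
proof -
  have "of_nat (CARD('a)) = (0 :: 'a)"
    using CHAR_dvd_CARD[where 'a='a] of_nat_eq_0_iff_char_dvd by blast
  then show ?thesis by (subst of_nat_diff) (auto simp: Suc_leI)
qed

end

lemma odd_prime_powerE:
  assumes "odd_prime_power q"
  obtains p a where "prime p" "odd p" "a > 0" "q = p ^ a"
  using assms by (auto simp: odd_prime_power_def primepow_def)

section \<open>Linearised polynomials\<close>

context field_of_order
begin

text \<open>
  The coefficient of \<open>y ^ (p ^ i)\<close> in a linearised polynomial, extracted by summing \<open>f\<close> against
  the inverse character of the multiplicative group.  The sign is due to the number of nonzero
  elements being \<open>- 1\<close> in the field.  It is also applied to the factors of a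
  decomposition into products, which are arbitrary functions.
\<close>

definition frob_coeff :: "nat \<Rightarrow> ('a \<Rightarrow> 'a) \<Rightarrow> 'a" where
  "frob_coeff i f = - (\<Sum>y\<in>UNIV - {0}. inverse (y ^ (p ^ i)) * f y)"

lemma frob_coeff_sum: "frob_coeff i (\<lambda>y. \<Sum>t\<in>A. f t y) = (\<Sum>t\<in>A. frob_coeff i (f t))"
  by (simp add: frob_coeff_def sum_distrib_left sum_negf sum.swap[of _ A])

lemma frob_coeff_scale: "frob_coeff i (\<lambda>y. c * f y) = c * frob_coeff i f"
  by (simp add: frob_coeff_def sum_distrib_left mult_ac)

text \<open>
  Orthogonality of characters: substituting \<open>z * y\<close> for \<open>y\<close> multiplies the sum by the value at
  \<open>z\<close> of a character, which differs from 1 for a suitable \<open>z\<close> unless the exponents agree.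
\<close>

lemma frob_coeff_frob: "frob_coeff i (\<lambda>y. y ^ (p ^ j)) = (if [i = j] (mod N) then 1 else 0)"
proof (cases "[i = j] (mod N)")
  case True
  have "frob_coeff i (\<lambda>y. y ^ (p ^ j)) = - (\<Sum>y::'a\<in>UNIV - {0}. 1)"
    unfolding frob_coeff_def
    by (intro arg_cong[where f=uminus] sum.cong refl) (use frob_cong[OF True] in simp)
  also have "\<dots> = - of_nat (CARD('a) - 1)" by simp
  finally show ?thesis using True of_nat_card_minus_one by simp
next
  case False
  then obtain z :: 'a where z: "z \<noteq> 0" "z ^ (p ^ i) \<noteq> z ^ (p ^ j)" using frob_distinct by blast
  let ?S = "\<Sum>y::'a\<in>UNIV - {0}. inverse (y ^ (p ^ i)) * y ^ (p ^ j)"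
  have "?S = (\<Sum>y\<in>UNIV - {0}. inverse ((z * y) ^ (p ^ i)) * (z * y) ^ (p ^ j))"
    by (rule sum.reindex_bij_witness[of _ "\<lambda>y. z * y" "\<lambda>y. y / z"]) (use z in auto)
  also have "\<dots> = inverse (z ^ (p ^ i)) * z ^ (p ^ j) * ?S"
    by (simp add: sum_distrib_left power_mult_distrib mult_ac)
  finally have "(1 - inverse (z ^ (p ^ i)) * z ^ (p ^ j)) * ?S = 0" by (simp add: algebra_simps)
  moreover have "1 - inverse (z ^ (p ^ i)) * z ^ (p ^ j) \<noteq> 0"
    using z by (simp add: field_simps)
  ultimately show ?thesis using False by (simp add: frob_coeff_def)
qed

lemma frob_coeff_term:
  "frob_coeff i (\<lambda>y. c * y ^ (p ^ j)) = (if [i = j] (mod N) then c else 0)"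
  by (simp add: frob_coeff_scale frob_coeff_frob)

lemma sum_powers:
  fixes r :: 'a
  shows "(\<Sum>k\<in>{1..<CARD('a)}. r ^ k) = (if r = 1 then - 1 else 0)"
proof (cases "r = 1")
  case False
  have "(r - 1) * (\<Sum>k\<in>{1..<CARD('a)}. r ^ k) = r ^ CARD('a) - r"
    using sum_Suc_diff'[of 1 "CARD('a)" "\<lambda>k. r ^ k"] by (simp add: sum_distrib_left algebra_simps Suc_leI)
  then show ?thesis using False by (simp add: power_card_eq_self)
qed (use of_nat_card_minus_one in auto)

text \<open>
  Write \<open>k = p ^ e * m\<close> with \<open>m\<close> prime to \<open>p\<close>.  Frobenius powers are injective, so the map
  \<open>x \<mapsto> x ^ m\<close> is additive as well; if \<open>m > 1\<close>, then \<open>(1 + X) ^ m - 1 - X ^ m\<close> has the nonzero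
  coefficient \<open>m\<close> at \<open>X\<close> and too many roots.
\<close>

lemma additive_power_exponent:
  assumes "additive (\<lambda>x::'a. x ^ k)" "0 < k" "k < CARD('a)"
  shows "\<exists>e<N. k = p ^ e"
proof -
  obtain e m where em: "\<not> p dvd m" "k = p ^ e * m"
    using prime_power_canonical[OF prime, of k] assms by auto
  have fm: "(x + 1 :: 'a) ^ m = x ^ m + 1" for x
  proof -
    have "((x + 1) ^ m) ^ (p ^ e) = (x ^ m + 1) ^ (p ^ e)"
      using additive.add[OF assms(1), of x 1] by (simp add: frob_add em mult.commute flip: power_mult)
    then show ?thesis by (simp only: frob_inj)
  qed
  have "m = 1"
  proof (rule ccontr)
    assume "m \<noteq> 1"
    with em assms have m: "m > 1" by (cases m) auto
    define P where "P = [:1, 1 :: 'a:] ^ m - monom 1 m - 1"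
    have "coeff P 1 = of_nat m"
      using m by (simp add: P_def coeff_linear_poly_power)
    moreover have "of_nat m \<noteq> (0 :: 'a)"
      using em CHAR_eq by (simp add: of_nat_eq_0_iff_char_dvd)
    ultimately have "P \<noteq> 0" by auto
    then have "card {x. poly P x = 0} \<le> degree P" by (rule card_poly_roots_bound)
    moreover have "{x. poly P x = 0} = UNIV"
      using fm by (auto simp: P_def poly_monom poly_power add.commute)
    moreover have "degree P \<le> m"
      unfolding P_def by (intro degree_diff_le) (auto simp: degree_linear_power degree_monom_le)
    moreover have "m \<le> k" using em assms by (cases "p ^ e") auto
    ultimately show False using assms(3) by auto
  qed
  then have "k = p ^ e" using em by simp
  moreover from this have "e < N" using assms(3) p_gt_1 by (simp add: card)
  ultimately show ?thesis by blast
qed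

text \<open>
  Interpolation writes any \<open>g\<close> with \<open>g 0 = 0\<close> as a polynomial of degree less than the order of
  the field.  Averaging the dilations \<open>x \<mapsto> g (c * x)\<close> against \<open>c \<mapsto> c powi (- k)\<close> isolates its term
  of degree \<open>k\<close>, and preserves additivity.  Hence only additive power maps occur.
\<close>

lemma additive_linearized:
  fixes g :: "'a \<Rightarrow> 'a"
  assumes g: "additive g"
  shows "\<exists>c. \<forall>z. g z = (\<Sum>e<N. c e * z ^ (p ^ e))"
proof -
  define A where "A k = (\<Sum>y\<in>UNIV - {0}. inverse (y ^ k) * g y)" for k :: nat
  have interpolation: "g x = - (\<Sum>k\<in>{1..<CARD('a)}. A k * x ^ k)" for x
  proof -
    have "(\<Sum>k\<in>{1..<CARD('a)}. A k * x ^ k) =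
      (\<Sum>y\<in>UNIV - {0}. g y * (\<Sum>k\<in>{1..<CARD('a)}. (x / y) ^ k))"
      unfolding A_def sum_distrib_right sum_distrib_left
      by (subst sum.swap) (simp add: power_divide field_simps)
    also have "\<dots> = (\<Sum>y\<in>UNIV - {0}. if y = x then - g x else 0)"
      unfolding sum_powers by (intro sum.cong) auto
    also have "\<dots> = - g x" using additive.zero[OF g] by (auto simp: sum.delta')
    finally show ?thesis by simp
  qed
  have scaled: "A k * x ^ k = (\<Sum>c\<in>UNIV - {0}. inverse (c ^ k) * g (c * x))" if "k > 0" for k x
  proof (cases "x = 0")
    case False
    have "A k * x ^ k = (\<Sum>c\<in>UNIV - {0}. inverse ((c * x) ^ k) * g (c * x)) * x ^ k"
      unfolding A_def
      by (intro arg_cong[where f="\<lambda>s. s * x ^ k"]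
          sum.reindex_bij_witness[of _ "\<lambda>c. c * x" "\<lambda>y. y / x"]) (use False in auto)
    also have "\<dots> = (\<Sum>c\<in>UNIV - {0}. inverse (c ^ k) * g (c * x))"
      unfolding sum_distrib_right using False
      by (intro sum.cong refl) (simp add: power_mult_distrib)
    finally show ?thesis .
  qed (use additive.zero[OF g] that in auto)
  have zero: "A k = 0" if k: "k \<in> {1..<CARD('a)} - (\<lambda>e. p ^ e) ` {..<N}" for k
  proof (rule ccontr)
    assume "A k \<noteq> 0"
    moreover have "A k * (x + y) ^ k = A k * x ^ k + A k * y ^ k" for x y
      using k by (simp add: scaled additive.add[OF g] algebra_simps sum.distrib)
    ultimately have "additive (\<lambda>x::'a. x ^ k)"
      by (simp add: additive_def flip: distrib_left)
    from additive_power_exponent[OF this] k show False by auto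
  qed
  have "g z = (\<Sum>e<N. - A (p ^ e) * z ^ (p ^ e))" for z
  proof -
    have inj: "inj_on (\<lambda>e. p ^ e) {..<N}"
      using p_gt_1 by (intro inj_onI) (simp add: power_inject_exp)
    have "(\<Sum>k\<in>{1..<CARD('a)}. A k * z ^ k) = (\<Sum>k\<in>(\<lambda>e. p ^ e) ` {..<N}. A k * z ^ k)"
    proof (rule sum.mono_neutral_right)
      show "(\<lambda>e. p ^ e) ` {..<N} \<subseteq> {1..<CARD('a)}"
        using p_gt_1 by (auto simp: card Suc_le_eq)
    qed (use zero in auto)
    then show ?thesis using inj
      by (simp add: interpolation sum.reindex sum_negf)
  qed
  then show ?thesis by (intro exI[of _ "\<lambda>e. - A (p ^ e)"]) blast
qed

end

section \<open>The rank of a biadditive map\<close>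

text \<open>
  Gaussian elimination: an unknown \<open>s\<close> with nonzero coefficient in the last equation is
  eliminated from the other ones.
\<close>

lemma homogeneous_system_nontrivial:
  fixes v :: "'t \<Rightarrow> nat \<Rightarrow> 'f::field"
  assumes "finite A" "R < card A"
  shows "\<exists>l. (\<exists>t\<in>A. l t \<noteq> 0) \<and> (\<forall>r<R. (\<Sum>t\<in>A. l t * v t r) = 0)"
  using assms
proof (induction R arbitrary: A v)
  case 0
  then have "A \<noteq> {}" by auto
  then show ?case by (intro exI[of _ "\<lambda>_. 1"]) auto
next
  case (Suc R)
  show ?case
  proof (cases "\<exists>s\<in>A. v s R \<noteq> 0")
    case False
    obtain l where "\<exists>t\<in>A. l t \<noteq> 0" "\<forall>r<R. (\<Sum>t\<in>A. l t * v t r) = 0"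
      using Suc.IH[of A v] Suc.prems by auto
    then show ?thesis using False by (intro exI[of _ l]) (auto simp: less_Suc_eq)
  next
    case True
    then obtain s where s: "s \<in> A" "v s R \<noteq> 0" by blast
    define v' where "v' t r = v t r - v t R / v s R * v s r" for t r
    have "R < card (A - {s})" using Suc.prems s by (simp add: card_Diff_singleton)
    then obtain l where l: "\<exists>t\<in>A - {s}. l t \<noteq> 0" "\<forall>r<R. (\<Sum>t\<in>A - {s}. l t * v' t r) = 0"
      using Suc.IH[of "A - {s}" v'] Suc.prems by auto
    define l' where "l' t = (if t = s then - (\<Sum>t\<in>A - {s}. l t * v t R) / v s R else l t)" for t
    have split: "(\<Sum>t\<in>A. l' t * v t r) = (\<Sum>t\<in>A - {s}. l t * v' t r)" for r
    proof -
      have "(\<Sum>t\<in>A. l' t * v t r) = l' s * v s r + (\<Sum>t\<in>A - {s}. l t * v t r)"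
        using Suc.prems s by (subst sum.remove[of _ s]) (auto simp: l'_def)
      also have "l' s * v s r = - (\<Sum>t\<in>A - {s}. l t * (v t R / v s R * v s r))"
        by (simp add: l'_def sum_divide_distrib sum_distrib_right mult.assoc)
      finally show ?thesis by (simp add: v'_def right_diff_distrib sum_subtractf)
    qed
    have "v' t R = 0" for t using s by (simp add: v'_def)
    then have "(\<Sum>t\<in>A. l' t * v t r) = 0" if "r < Suc R" for r
      using l(2) that by (auto simp: split less_Suc_eq)
    moreover have "\<exists>t\<in>A. l' t \<noteq> 0" using l(1) by (auto simp: l'_def)
    ultimately show ?thesis by blast
  qed
qed

context field_of_order
begin

lemma linearized_biadditive:
  fixes B :: "'a \<Rightarrow> 'a \<Rightarrow> 'a" and g :: "'a \<Rightarrow> 'a"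
  assumes B: "\<And>x y. B x y = (\<Sum>t<R. w t * x ^ (p ^ i t) * y ^ (p ^ j t))"
  assumes g: "\<And>z. g z = (\<Sum>e<N. c e * z ^ (p ^ e))"
  shows "frob_coeff I (\<lambda>x. frob_coeff J (\<lambda>y. g (B x y))) =
    (\<Sum>e<N. \<Sum>t<R. if [I = e + i t] (mod N) \<and> [J = e + j t] (mod N) then c e * w t ^ (p ^ e) else 0)"
proof -
  have "g (B x y) = (\<Sum>e<N. \<Sum>t<R. (c e * w t ^ (p ^ e) * x ^ (p ^ (e + i t))) * y ^ (p ^ (e + j t)))" for x y
    by (simp add: g B frob_sum power_mult_distrib sum_distrib_left power_add mult_ac flip: power_mult)
  then have "frob_coeff J (\<lambda>y. g (B x y)) =
     (\<Sum>e<N. \<Sum>t<R. (if [J = e + j t] (mod N) then c e * w t ^ (p ^ e) else 0) * x ^ (p ^ (e + i t)))" for x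
    by (simp only: frob_coeff_sum frob_coeff_term) (intro sum.cong refl, auto)
  then show ?thesis
    by (simp only: frob_coeff_sum frob_coeff_term) (intro sum.cong refl, auto)
qed

text \<open>
  Consider the monomials of \<open>B\<close> as arrows from \<open>i t\<close> to \<open>j t\<close>.  By the assumption \<open>diff\<close>, a
  source and a target that differ by the same amount as an arrow \<open>s\<close> are the ends of \<open>s\<close>.  If \<open>z ^ (p ^ k)\<close> occurs in \<open>g\<close>, then the rows \<open>k + i t\<close> and the columns \<open>k + j t\<close>
  of the coefficient matrix of \<open>g (B x y)\<close> form a diagonal block with nonzero diagonal,
  because every other monomial of \<open>g\<close> shifts the arrows out of the block.  Such a
  block of size \<open>R\<close> is not a sum of fewer than \<open>R\<close> rank-one matrices.
\<close>

lemma sparse_biadditive_rank: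
  fixes B :: "'a \<Rightarrow> 'a \<Rightarrow> 'a" and g :: "'a \<Rightarrow> 'a" and \<phi> \<psi> :: "nat \<Rightarrow> 'a \<Rightarrow> 'a"
  assumes B: "\<And>x y. B x y = (\<Sum>t<R. w t * x ^ (p ^ i t) * y ^ (p ^ j t))"
  assumes w: "\<And>t. t < R \<Longrightarrow> w t \<noteq> 0"
  assumes diff: "\<And>t t' s. \<lbrakk>t < R; t' < R; s < R; [i s + j t' = i t + j s] (mod N)\<rbrakk> \<Longrightarrow> t = s \<and> t' = s"
  assumes g: "additive g" "g z \<noteq> 0"
  assumes "R' < R"
  assumes rank: "\<And>x y. g (B x y) = (\<Sum>r<R'. \<phi> r x * \<psi> r y)"
  shows False
proof -
  obtain c where c: "\<And>z. g z = (\<Sum>e<N. c e * z ^ (p ^ e))"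
    using additive_linearized[OF g(1)] by blast
  have "\<exists>k<N. c k \<noteq> 0"
  proof (rule ccontr)
    assume "\<not> ?thesis"
    then have "g z = 0" by (simp add: c)
    with g(2) show False by simp
  qed
  then obtain k where k: "k < N" "c k \<noteq> 0" by blast
  \<comment> \<open>the coefficient at row \<open>k + i t\<close> and column \<open>k + j t'\<close>\<close>
  define M where "M t t' = frob_coeff (k + i t) (\<lambda>x. frob_coeff (k + j t') (\<lambda>y. g (B x y)))" for t t'
  have diag: "M t t' = (if t = t' then c k * w t ^ (p ^ k) else 0)" if t: "t < R" "t' < R" for t t'
  proof -
    have "([k + i t = e + i s] (mod N) \<and> [k + j t' = e + j s] (mod N)) \<longleftrightarrow> t = t' \<and> s = t \<and> e = k"
      if "s < R" "e < N" for s e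
    proof
      assume *: "[k + i t = e + i s] (mod N) \<and> [k + j t' = e + j s] (mod N)"
      have "[(e + i s) + (k + j t') = (k + i t) + (e + j s)] (mod N)"
        using cong_add[OF cong_sym[OF conjunct1[OF *]] conjunct2[OF *]] .
      then have "[(e + k) + (i s + j t') = (e + k) + (i t + j s)] (mod N)"
        by (simp add: algebra_simps)
      then have "[i s + j t' = i t + j s] (mod N)" by (simp only: cong_add_lcancel_nat)
      with diff[of t t' s] t that have "t = s" "t' = s" by auto
      moreover from this * have "[k = e] (mod N)" by (simp only: cong_add_rcancel_nat)
      ultimately show "t = t' \<and> s = t \<and> e = k" using k that by (simp add: cong_def)
    qed auto
    then have "M t t' = (\<Sum>e<N. \<Sum>s<R. if e = k \<and> s = t then if t = t' then c k * w t ^ (p ^ k) else 0 else 0)"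
      unfolding M_def linearized_biadditive[OF B c]
      by (intro sum.cong refl) auto
    also have "\<dots> = (\<Sum>e<N. if e = k then \<Sum>s<R. if s = t then if t = t' then c k * w t ^ (p ^ k) else 0 else 0 else 0)"
      by (intro sum.cong refl) auto
    finally show ?thesis using k t by simp
  qed
  have low: "M t t' = (\<Sum>r<R'. frob_coeff (k + i t) (\<phi> r) * frob_coeff (k + j t') (\<psi> r))" for t t'
  proof -
    have "frob_coeff (k + j t') (\<lambda>y. g (B x y)) = (\<Sum>r<R'. frob_coeff (k + j t') (\<psi> r) * \<phi> r x)" for x
      by (simp add: rank frob_coeff_sum frob_coeff_scale mult.commute)
    then show ?thesis
      by (simp only: M_def frob_coeff_sum frob_coeff_scale) (simp only: mult.commute)
  qed
  obtain l where l: "\<exists>t\<in>{..<R}. l t \<noteq> 0"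
    "\<And>r. r < R' \<Longrightarrow> (\<Sum>t<R. l t * frob_coeff (k + i t) (\<phi> r)) = 0"
    using homogeneous_system_nontrivial[of "{..<R}" R' "\<lambda>t r. frob_coeff (k + i t) (\<phi> r)"] \<open>R' < R\<close>
    by auto
  have "l t' = 0" if "t' < R" for t'
  proof -
    have "(\<Sum>t<R. l t * M t t') =
        (\<Sum>r<R'. (\<Sum>t<R. l t * frob_coeff (k + i t) (\<phi> r)) * frob_coeff (k + j t') (\<psi> r))"
      unfolding low sum_distrib_left sum_distrib_right by (subst sum.swap) (simp add: mult_ac)
    also have "\<dots> = 0" by (simp add: l(2))
    also have "(\<Sum>t<R. l t * M t t') = (\<Sum>t<R. if t = t' then l t * (c k * w t ^ (p ^ k)) else 0)"
      by (intro sum.cong refl) (use diag that in auto)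
    finally show ?thesis using that k w[OF that] by (simp add: frob_eq_0_iff)
  qed
  then show False using l(1) by auto
qed

end

section \<open>Embeddings of finite fields\<close>

text \<open>
  Integer polynomials serve as common expressions that can be evaluated in two different
  fields of the same characteristic.
\<close>

definition int_eval :: "'r::comm_ring_1 \<Rightarrow> int poly \<Rightarrow> 'r" where
  "int_eval x T = poly (map_poly of_int T) x"

lemma int_eval_0 [simp]: "int_eval x 0 = 0"
  by (simp add: int_eval_def)

lemma int_eval_pCons [simp]: "int_eval x (pCons c T) = of_int c + x * int_eval x T"
  by (simp add: int_eval_def map_poly_pCons)

lemma int_eval_1 [simp]: "int_eval x 1 = 1"
  by (simp add: one_pCons)

lemma int_eval_add [simp]: "int_eval x (S + T) = int_eval x S + int_eval x T"
  by (induction S T rule: poly_induct2) (auto simp: algebra_simps)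

lemma int_eval_smult [simp]: "int_eval x (smult c T) = of_int c * int_eval x T"
  by (induction T) (auto simp: algebra_simps)

lemma int_eval_minus [simp]: "int_eval x (- T) = - int_eval x T"
  using int_eval_smult[of x "- 1" T] by simp

lemma int_eval_diff [simp]: "int_eval x (S - T) = int_eval x S - int_eval x T"
  using int_eval_add[of x S "- T"] by simp

lemma int_eval_mult [simp]: "int_eval x (S * T) = int_eval x S * int_eval x T"
  by (induction S) (auto simp: algebra_simps)

lemma int_eval_power [simp]: "int_eval x (T ^ n) = int_eval x T ^ n"
  by (induction n) auto

lemma int_eval_prod [simp]: "int_eval x (prod f A) = (\<Prod>i\<in>A. int_eval x (f i))"
  by (induction A rule: infinite_finite_induct) auto

lemma int_eval_monom [simp]: "int_eval x (monom c n) = of_int c * x ^ n"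
  by (induction n) (auto simp: monom_0 monom_Suc algebra_simps)

text \<open>
  Modulo the characteristic, a polynomial that vanishes on the whole field with \<open>Q\<close> elements is
  a multiple of \<open>X ^ Q - X\<close>, and so it vanishes at \<open>u\<close> too.  The induction on the degree is the
  division by \<open>X ^ Q - X\<close>.
\<close>

lemma int_eval_vanishing:
  fixes u :: "'b::{field, finite}"
  assumes "CHAR('b) = CHAR('a::{field, finite})" "u ^ CARD('a) = u"
  assumes "\<And>x :: 'a. int_eval x T = 0"
  shows "int_eval u T = 0"
  using assms(3)
proof (induction "degree T" arbitrary: T rule: less_induct)
  case less
  let ?Q = "CARD('a)"
  show ?case
  proof (cases "degree T < ?Q")
    case True
    have "map_poly of_int T = (0 :: 'a poly)"
    proof (rule ccontr)
      assume nz: "map_poly of_int T \<noteq> (0 :: 'a poly)"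
      have "card {x :: 'a. poly (map_poly of_int T) x = 0} \<le> degree (map_poly of_int T :: 'a poly)"
        by (rule card_poly_roots_bound[OF nz])
      also have "\<dots> \<le> degree T" by (rule degree_le) (auto simp: coeff_map_poly coeff_eq_0)
      also have "{x :: 'a. poly (map_poly of_int T) x = 0} = UNIV"
        using less.prems by (simp add: int_eval_def)
      finally show False using True by simp
    qed
    then have "of_int (coeff T k) = (0 :: 'a)" for k
      by (metis coeff_0 coeff_map_poly of_int_0)
    then have "of_int (coeff T k) = (0 :: 'b)" for k
      using assms(1) by (metis of_int_eq_0_iff_char_dvd)
    then have "map_poly of_int T = (0 :: 'b poly)" by (simp add: poly_eq_iff coeff_map_poly)
    then show ?thesis by (simp add: int_eval_def)
  next
    case False
    define d where "d = degree T - ?Q"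
    have deg: "degree T = ?Q + d" using False by (simp add: d_def)
    have Q: "?Q \<ge> 2" by (rule card_field_ge_2)
    \<comment> \<open>a multiple of \<open>X ^ Q - X\<close> with the same leading term as \<open>T\<close>\<close>
    define S where "S = monom (lead_coeff T) (?Q + d) - monom (lead_coeff T) (Suc d)"
    have S: "int_eval x S = 0" if "x ^ ?Q = x" for x :: "'r::comm_ring_1"
      using that by (simp add: S_def power_add)
    have "degree (T - S) < degree T"
    proof (rule degree_lessI)
      show "T - S \<noteq> 0 \<or> 0 < degree T" using Q deg by auto
      show "\<forall>k\<ge>degree T. coeff (T - S) k = 0"
        using Q deg by (auto simp: S_def coeff_eq_0)
    qed
    moreover have "int_eval x (T - S) = 0" for x :: 'a
      using less.prems S[of x] by (simp add: power_card_eq_self)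
    ultimately have "int_eval u (T - S) = 0" using less.hyps by blast
    then show ?thesis using S[OF assms(2)] by simp
  qed
qed

text \<open>
  Let \<open>u\<close> be a primitive element of the smaller field.  It suffices to find \<open>w\<close> in the larger field
  that is a root of every integer polynomial vanishing at \<open>u\<close>: then \<open>T(u) \<mapsto> T(w)\<close> is a
  well-defined homomorphism.  If there were none, then each \<open>w\<close> would be missed by some \<open>T w\<close>, and
  the product of the polynomials \<open>1 - T w ^ (Q - 1)\<close> would vanish on the larger field but be 1 at
  \<open>u\<close>, contrary to \<open>int_eval_vanishing\<close>.
\<close>

lemma finite_field_embedding:
  assumes p: "prime p" "CARD('a::{field, finite}) = p ^ N" "CARD('a) = CARD('b::{field, finite}) ^ j"
  shows "\<exists>h :: 'b \<Rightarrow> 'a. additive h \<and> (\<forall>x y. h (x * y) = h x * h y) \<and> (\<forall>x. h x = 0 \<longleftrightarrow> x = 0)"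
proof -
  interpret a: field_of_order "TYPE('a)" p N by unfold_locales (use p in auto)
  have "j > 0" using p(3) card_field_ge_2[where 'a='a] by (cases j) auto
  then have "CARD('b) dvd p ^ N" using p(2,3) by (metis dvd_power)
  then obtain M where "CARD('b) = p ^ M" using divides_primepow_nat[OF p(1)] by blast
  then interpret b: field_of_order "TYPE('b)" p M by unfold_locales (use p in auto)
  have char: "CHAR('b) = CHAR('a)" using a.CHAR_eq b.CHAR_eq by simp
  obtain u :: 'b where u: "primitive_element u" using ex_primitive_element by blast
  have uQ: "u ^ CARD('a) = u"
    unfolding p(3) by (induction j) (auto simp: power_mult power_card_eq_self)
  have Q: "CARD('a) - 1 > 0" using card_field_ge_2[where 'a='a] by simp
  have "\<exists>w :: 'a. \<forall>T. int_eval u T = 0 \<longrightarrow> int_eval w T = 0"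
  proof (rule ccontr)
    assume "\<not> ?thesis"
    then have "\<forall>w :: 'a. \<exists>T. int_eval u T = 0 \<and> int_eval w T \<noteq> 0" by blast
    then obtain T where T: "\<And>w. int_eval u (T w) = 0" "\<And>w :: 'a. int_eval w (T w) \<noteq> 0" by metis
    \<comment> \<open>the factor for \<open>w\<close> vanishes at \<open>w\<close> because nonzero elements have \<open>(Q - 1)\<close>-th power 1\<close>
    define E where "E = (\<Prod>w\<in>UNIV. 1 - T w ^ (CARD('a) - 1))"
    have "int_eval z E = 0" for z :: 'a
      using power_card_minus_one[OF T(2)[of z]]
      by (auto simp: E_def intro!: prod_zero bexI[of _ z])
    then have "int_eval u E = 0" by (rule int_eval_vanishing[OF char uQ])
    moreover have "int_eval u E = 1" using Q by (simp add: E_def T(1) zero_power)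
    ultimately show False by simp
  qed
  then obtain w :: 'a where w: "\<And>T. int_eval u T = 0 \<Longrightarrow> int_eval w T = 0" by blast
  have w_eq: "int_eval w S = int_eval w T" if "int_eval u S = int_eval u T" for S T
    using w[of "S - T"] that by simp
  have "\<exists>T. int_eval u T = b" for b
  proof (cases "b = 0")
    case False
    then have "b \<in> range (\<lambda>k. u ^ k)" using u by (auto simp: primitive_element_def)
    then obtain k where "b = u ^ k" by blast
    then show ?thesis by (intro exI[of _ "monom 1 k"]) simp
  qed (auto intro: exI[of _ 0])
  then obtain R where R: "\<And>b. int_eval u (R b) = b" by metis
  define h where "h b = int_eval w (R b)" for b
  have h: "h (int_eval u T) = int_eval w T" for T
    unfolding h_def by (rule w_eq) (simp add: R)
  have add: "h (x + y) = h x + h y" and mult: "h (x * y) = h x * h y" for x y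
    using h[of "R x + R y"] h[of "R x * R y"] by (simp_all add: R h_def)
  have zero: "h x = 0 \<longleftrightarrow> x = 0" for x
    using h[of 0] h[of 1] mult[of x "inverse x"] by (cases "x = 0") auto
  show ?thesis using add mult zero by (intro exI[of _ h]) (auto simp: additive_def)
qed

section \<open>Two invariants of isotopy\<close>

text \<open>
  The field of values need not be the domain of the multiplication, because some of the
  multiplications act on pairs.  The rank is bounded by \<open>R\<close>, not required to be equal to it, since
  products may be zero.
\<close>

definition has_component_of_rank :: "'k::field itself \<Rightarrow> nat \<Rightarrow> ('s::ab_group_add \<Rightarrow> 's \<Rightarrow> 's) \<Rightarrow> bool" where
  "has_component_of_rank K R star \<longleftrightarrow>
     (\<exists>\<pi> :: 's \<Rightarrow> 'k. \<exists>\<phi> \<psi>. additive \<pi> \<and> (\<exists>z. \<pi> z \<noteq> 0) \<and>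
        (\<forall>x y. \<pi> (star x y) = (\<Sum>r<R. \<phi> r x * \<psi> r y)))"

lemma has_component_of_rank_3I:
  fixes \<pi> :: "'s::ab_group_add \<Rightarrow> 'k::field"
  assumes "additive \<pi>" "\<pi> z \<noteq> 0"
    "\<And>x y. \<pi> (star x y) = f1 x * g1 y + f2 x * g2 y + f3 x * g3 y"
  shows "has_component_of_rank TYPE('k) 3 star"
  unfolding has_component_of_rank_def
  by (rule exI[of _ \<pi>], rule exI[of _ "\<lambda>r. [f1, f2, f3] ! r"], rule exI[of _ "\<lambda>r. [g1, g2, g3] ! r"])
     (use assms in \<open>auto simp: numeral_3_eq_3\<close>)

lemma isotopicE:
  assumes "isotopic star star'"
  obtains g1 g2 g3 where "additive g1" "bij g1" "additive g2" "bij g2" "additive g3" "bij g3"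
    "\<And>x y. star' (g1 x) (g2 y) = g3 (star x y)"
  using assms unfolding isotopic_def prime_field_linear_def additive_def by metis

lemma isotopic_card:
  fixes star :: "'s::{finite, ab_group_add} \<Rightarrow> 's \<Rightarrow> 's" and star' :: "'t::{finite, ab_group_add} \<Rightarrow> 't \<Rightarrow> 't"
  assumes "isotopic star star'"
  shows "CARD('s) = CARD('t)"
  using assms by (elim isotopicE) (auto intro: bij_betw_same_card)

text \<open>
  If \<open>\<pi>\<close> defines the component of the second multiplication, then \<open>\<pi> \<circ> g3\<close> defines one of the
  first.  The homomorphism \<open>h\<close> moves the values into the field in which ranks are to be
  compared.
\<close>

lemma isotopic_component_of_rank:
  fixes star :: "'s::{finite, ab_group_add} \<Rightarrow> 's \<Rightarrow> 's" and star' :: "'t::{finite, ab_group_add} \<Rightarrow> 't \<Rightarrow> 't"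
    and h :: "'k::field \<Rightarrow> 'l::field"
  assumes "isotopic star star'" "has_component_of_rank TYPE('k) R star'"
    and h: "additive h" "\<And>x y. h (x * y) = h x * h y" "\<And>x. h x = 0 \<longleftrightarrow> x = 0"
  shows "has_component_of_rank TYPE('l) R star"
proof -
  obtain g1 g2 g3 where g: "additive g3" "bij g3" "\<And>x y. star' (g1 x) (g2 y) = g3 (star x y)"
    using isotopicE[OF assms(1)] by metis
  obtain \<pi> :: "'t \<Rightarrow> 'k" and \<phi> \<psi> z where \<pi>: "additive \<pi>" "\<pi> z \<noteq> 0"
    "\<And>x y. \<pi> (star' x y) = (\<Sum>r<R. \<phi> r x * \<psi> r y)"
    using assms(2) by (auto simp: has_component_of_rank_def)
  obtain z' where "g3 z' = z" using g(2) by (metis bij_pointE)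
  then have "h (\<pi> (g3 z')) \<noteq> 0" using \<pi> h by simp
  moreover have "additive (\<lambda>z. h (\<pi> (g3 z)))"
    using g \<pi> h by (simp add: additive_def)
  moreover have "h (\<pi> (g3 (star x y))) = (\<Sum>r<R. h (\<phi> r (g1 x)) * h (\<psi> r (g2 y)))" for x y
    by (simp add: \<pi> h additive.sum flip: g(3))
  ultimately show ?thesis
    unfolding has_component_of_rank_def
    by (intro exI[of _ "\<lambda>z. h (\<pi> (g3 z))"] exI[of _ "\<lambda>r x. h (\<phi> r (g1 x))"]
          exI[of _ "\<lambda>r y. h (\<psi> r (g2 y))"]) blast
qed

text \<open>
  For a semifield, \<open>g\<close> has a partner \<open>f\<close> exactly if it is the multiplication by an element
  of the middle nucleus.  This description does not refer to an identity element, so it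
  applies to presemifields, and the number of such maps is an isotopy invariant.
\<close>

definition middle_nucleus :: "('s::{finite, ab_group_add} \<Rightarrow> 's \<Rightarrow> 's) \<Rightarrow> ('s \<Rightarrow> 's) set" where
  "middle_nucleus star = {g. additive g \<and> (\<exists>f. \<forall>x y. star (f x) y = star x (g y))}"

text \<open>
  Conjugation with the second isotopism map is a bijection.
\<close>

lemma isotopic_card_middle_nucleus:
  assumes "isotopic star star'"
  shows "card (middle_nucleus star) = card (middle_nucleus star')"
proof -
  obtain g1 g2 g3 where g: "additive g1" "bij g1" "additive g2" "bij g2" "additive g3" "bij g3"
    "\<And>x y. star' (g1 x) (g2 y) = g3 (star x y)"
    using isotopicE[OF assms] by metis
  define i1 where "i1 = inv_into UNIV g1"
  define i2 where "i2 = inv_into UNIV g2"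
  have inv: "i1 (g1 x) = x" "g1 (i1 x') = x'" "i2 (g2 x) = x" "g2 (i2 x') = x'"
    for x x' using g(2,4) by (simp_all add: i1_def i2_def bij_is_inj bij_is_surj inv_into_f_f f_inv_into_f)
  have g3_eq: "g3 a = g3 b \<longleftrightarrow> a = b" for a b using g(6) by (simp add: bij_is_inj inj_eq)
  have add_inv: "i2 (x + y) = i2 x + i2 y" for x y
    by (metis inv(3,4) additive.add[OF g(3)])
  have "bij_betw (\<lambda>k x. g2 (k (i2 x))) (middle_nucleus star) (middle_nucleus star')"
  proof (rule bij_betwI[where g="\<lambda>k x. i2 (k (g2 x))"])
    show "(\<lambda>k x. g2 (k (i2 x))) \<in> middle_nucleus star \<rightarrow> middle_nucleus star'"
    proof
      fix k assume "k \<in> middle_nucleus star"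
      then obtain f where k: "additive k" "\<And>x y. star (f x) y = star x (k y)"
        by (auto simp: middle_nucleus_def)
      have "star' (g1 (f (i1 x))) y = star' x (g2 (k (i2 y)))" for x y
        using g(7)[of "f (i1 x)" "i2 y"] g(7)[of "i1 x" "k (i2 y)"] k(2)
        by (simp add: inv)
      moreover have "additive (\<lambda>x. g2 (k (i2 x)))"
        using g(3) k(1) by (simp add: additive_def add_inv)
      ultimately show "(\<lambda>x. g2 (k (i2 x))) \<in> middle_nucleus star'"
        unfolding middle_nucleus_def by (auto intro!: exI[of _ "\<lambda>x. g1 (f (i1 x))"])
    qed
    show "(\<lambda>k x. i2 (k (g2 x))) \<in> middle_nucleus star' \<rightarrow> middle_nucleus star"
    proof
      fix k assume "k \<in> middle_nucleus star'"
      then obtain f where k: "additive k" "\<And>x y. star' (f x) y = star' x (k y)"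
        by (auto simp: middle_nucleus_def)
      have "star (i1 (f (g1 x))) y = star x (i2 (k (g2 y)))" for x y
        using g(7)[of "i1 (f (g1 x))" y] g(7)[of x "i2 (k (g2 y))"] k(2)[of "g1 x" "g2 y"]
        by (simp add: inv g3_eq)
      moreover have "additive (\<lambda>x. i2 (k (g2 x)))"
        using g(3) k(1) by (simp add: additive_def add_inv)
      ultimately show "(\<lambda>x. i2 (k (g2 x))) \<in> middle_nucleus star"
        unfolding middle_nucleus_def by (auto intro!: exI[of _ "\<lambda>x. i1 (f (g1 x))"])
    qed
  qed (auto simp: inv)
  then show ?thesis by (rule bij_betw_same_card)
qed

section \<open>Components of Zha--Kyureghyan--Wang presemifields\<close>

lemma cong_mult_modulus: "a > 0 \<Longrightarrow> [a * x = a * y] (mod a * m) \<longleftrightarrow> [x = y] (mod m)" for a :: nat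
  by (simp add: cong_def flip: mult_mod_right)

text \<open>
  Modulo \<open>h\<close>, the exponents of the four monomials are \<open>0\<close> or \<open>n\<close>.  These two facts decide all
  congruences modulo \<open>h\<close> between sums of two of them.
\<close>

lemma odd_coprime_not_dvd_double:
  fixes h n :: nat
  assumes "odd h" "h > 1" "coprime h n"
  shows "\<not> h dvd n" "\<not> h dvd 2 * n"
proof -
  show "\<not> h dvd n"
    using assms by (metis coprime_absorb_left nat_dvd_1_iff_1 less_numeral_extra(4))
  moreover have "coprime h 2" using assms(1) by simp
  ultimately show "\<not> h dvd 2 * n"
    by (simp add: coprime_dvd_mult_right_iff)
qed

lemma zkw_exponents_independent:
  fixes h n :: nat and \<alpha> \<beta> :: int
  assumes h: "odd h" "h > 1" "coprime h n" and \<alpha>: "\<bar>\<alpha>\<bar> \<le> 2"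
    and "int (3 * h) dvd \<alpha> * int n + \<beta> * int h"
  shows "\<alpha> = 0 \<and> 3 dvd \<beta>"
proof -
  have "int h dvd \<alpha> * int n + \<beta> * int h"
    using assms(5) by (rule dvd_trans[rotated]) simp
  then have "int h dvd \<alpha> * int n" by (simp add: dvd_add_left_iff)
  then have "int h dvd \<bar>\<alpha>\<bar> * int n" by (simp add: abs_if)
  moreover have "\<not> int h dvd 1 * int n" "\<not> int h dvd 2 * int n"
    using odd_coprime_not_dvd_double[OF h] int_dvd_int_iff[of h "2 * n"] by auto
  ultimately have "\<bar>\<alpha>\<bar> \<noteq> 1" "\<bar>\<alpha>\<bar> \<noteq> 2" by metis+
  then have "\<alpha> = 0" using \<alpha> by linarith
  moreover from this have "3 dvd \<beta>" using assms(5) h by simp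
  ultimately show ?thesis by simp
qed

text \<open>
  The lists contain the exponents of \<open>q\<close> at \<open>x\<close> and at \<open>y\<close> in the four monomials.  All of them are
  combinations \<open>\<alpha> * n + \<beta> * h\<close>, so a congruence modulo \<open>3 * h\<close> amounts to the equality of the
  coefficients \<open>\<alpha>\<close> and the congruence modulo 3 of the coefficients \<open>\<beta>\<close>; this leaves finitely
  many cases.
\<close>

lemma zkw_differences:
  fixes h n :: nat
  defines "ex \<equiv> (\<lambda>t. [0, n, 2 * h, h + n] ! t)" and "ey \<equiv> (\<lambda>t. [n, 0, h + n, 2 * h] ! t)"
  assumes h: "odd h" "h > 1" "coprime h n" and t: "t < 4" "t' < 4" "s < 4"
    and cong: "[ex s + ey t' = ex t + ey s] (mod 3 * h)"
  shows "t = s \<and> t' = s"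
proof -
  \<comment> \<open>the coefficients of \<open>n\<close> and of \<open>h\<close> in the two lists of exponents\<close>
  define A where "A t = [0, 1, 0, 1 :: int] ! t" for t
  define B where "B t = [0, 0, 2, 1 :: int] ! t" for t
  define C where "C t = [1, 0, 1, 0 :: int] ! t" for t
  define D where "D t = [0, 0, 1, 2 :: int] ! t" for t
  have cases: "t \<in> {0, 1, 2, 3}" "t' \<in> {0, 1, 2, 3}" "s \<in> {0, 1, 2, 3}" using t by auto
  have ex: "int (ex r) = A r * int n + B r * int h" "int (ey r) = C r * int n + D r * int h"
    if "r \<in> {0, 1, 2, 3}" for r
    using that by (auto simp: ex_def ey_def A_def B_def C_def D_def)
  have "int (3 * h) dvd int (ex s + ey t') - int (ex t + ey s)"
    using cong by (simp only: cong_int_iff[symmetric] cong_iff_dvd_diff)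
  then have "int (3 * h) dvd (A s + C t' - A t - C s) * int n + (B s + D t' - B t - D s) * int h"
    using cases by (simp add: ex algebra_simps)
  moreover have "\<bar>A s + C t' - A t - C s\<bar> \<le> 2"
    using cases by (auto simp: A_def C_def)
  ultimately have "A s + C t' - A t - C s = 0" "3 dvd B s + D t' - B t - D s"
    using zkw_exponents_independent[OF h] by blast+
  then show ?thesis
    using cases by (auto simp: A_def B_def C_def D_def)
qed

theorem zkw_component_rank:
  fixes star :: "'a::{field, finite} \<Rightarrow> 'a \<Rightarrow> 'a"
  assumes zkw: "zha_kyureghyan_wang q h star" and h: "h > 1"
  shows "\<not> has_component_of_rank TYPE('a) 3 star"
proof
  assume "has_component_of_rank TYPE('a) 3 star"
  then obtain g :: "'a \<Rightarrow> 'a" and z and \<phi> \<psi> :: "nat \<Rightarrow> 'a \<Rightarrow> 'a" where g: "additive g" "g z \<noteq> 0"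
    "\<And>x y. g (star x y) = (\<Sum>r<3. \<phi> r x * \<psi> r y)"
    by (auto simp: has_component_of_rank_def)
  from zkw obtain n u v where z: "odd_prime_power q" "odd h" "CARD('a) = q ^ (3 * h)"
    "coprime h n" "primitive_element u" "v = u ^ (q ^ h - 1)"
    "star = (\<lambda>x y. y ^ (q ^ n) * x + y * x ^ (q ^ n)
                  - v * (y ^ (q ^ (h + n)) * x ^ (q ^ (2 * h))
                         + y ^ (q ^ (2 * h)) * x ^ (q ^ (h + n))))"
    unfolding zha_kyureghyan_wang_def by blast
  obtain p a where p: "prime p" "odd p" "a > 0" "q = p ^ a" using z(1) by (rule odd_prime_powerE)
  interpret field_of_order "TYPE('a)" p "a * (3 * h)"
    by unfold_locales (use p z in \<open>auto simp: power_mult\<close>)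
  have v: "v \<noteq> 0" using primitive_element_nonzero[OF z(5)] z(6) by simp
  define w where "w t = [1, 1, - v, - v] ! t" for t
  define ex where "ex = (\<lambda>t. [0, n, 2 * h, h + n] ! t)"
  define ey where "ey = (\<lambda>t. [n, 0, h + n, 2 * h] ! t)"
  have four: "{..<4::nat} = {0, 1, 2, 3}" by auto
  show False
  proof (rule sparse_biadditive_rank[OF _ _ _ g(1,2) _ g(3)])
    show "star x y = (\<Sum>t<4. w t * x ^ p ^ (a * ex t) * y ^ p ^ (a * ey t))" for x y
      by (simp add: four z(7) w_def ex_def ey_def p(4) algebra_simps flip: power_mult)
    show "w t \<noteq> 0" if "t < 4" for t
      using that v less_Suc_eq by (auto simp: w_def four numeral_eq_Suc)
    show "t = s \<and> t' = s" if "t < 4" "t' < 4" "s < 4"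
      "[a * ex s + a * ey t' = a * ex t + a * ey s] (mod a * (3 * h))" for t t' s
    proof (rule zkw_differences[OF z(2) h z(4) that(1-3)])
      have "[a * (ex s + ey t') = a * (ex t + ey s)] (mod a * (3 * h))"
        using that(4) by (simp only: distrib_left)
      then show "[[0, n, 2 * h, h + n] ! s + [n, 0, h + n, 2 * h] ! t' =
         [0, n, 2 * h, h + n] ! t + [n, 0, h + n, 2 * h] ! s] (mod 3 * h)"
        using cong_mult_modulus[OF p(3)] by (simp add: ex_def ey_def)
    qed
  qed simp
qed

section \<open>Families with a component of rank at most three\<close>

text \<open>
  In all four families the second coordinate is \<open>a d + b c\<close> plus a multiple of a power of
  \<open>b d\<close>, which is a sum of three products.
\<close>

lemma pair_families_component:
  fixes star :: "'b::{field, finite} \<times> 'b \<Rightarrow> 'b \<times> 'b \<Rightarrow> 'b \<times> 'b"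
  assumes "dickson star \<or> ganley star \<or> cohen_ganley star \<or>
    penttila_williams_bader_lunardon_pinneri star"
  shows "has_component_of_rank TYPE('b) 3 star"
proof -
  have "\<exists>c k. \<forall>x y. snd (star x y) = fst x * snd y + snd x * fst y + (c * snd x ^ k) * snd y ^ k"
    using assms
  proof (elim disjE)
    assume "dickson star"
    then show ?thesis by (intro exI[of _ 0]) (auto simp: dickson_def)
  next
    assume "ganley star"
    then show ?thesis by (intro exI[of _ 1] exI[of _ 3]) (auto simp: ganley_def)
  next
    assume "cohen_ganley star"
    then obtain j where "star = (\<lambda>(a, b) (c, d).
        (a * c + j * b * d + j ^ 3 * (b * d) ^ 9, a * d + b * c + j * (b * d) ^ 3))"
      by (auto simp: cohen_ganley_def)
    then show ?thesis
      by (intro exI[of _ j] exI[of _ 3]) (auto simp: power_mult_distrib mult_ac)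
  next
    assume "penttila_williams_bader_lunardon_pinneri star"
    then show ?thesis
      by (intro exI[of _ 1] exI[of _ 27])
         (auto simp: penttila_williams_bader_lunardon_pinneri_def power_mult_distrib)
  qed
  then obtain c k where
    "snd (star x y) = fst x * snd y + snd x * fst y + (c * snd x ^ k) * snd y ^ k" for x y by blast
  then show ?thesis
    by (intro has_component_of_rank_3I[of snd "(0, 1)"]) (auto simp: additive_def)
qed

lemma generalized_twisted_field_component:
  fixes star :: "'b::{field, finite} \<Rightarrow> 'b \<Rightarrow> 'b"
  assumes "generalized_twisted_field star"
  shows "has_component_of_rank TYPE('b) 3 star"
proof -
  obtain \<alpha> :: "'b \<Rightarrow> 'b" where "star = (\<lambda>x y. \<alpha> x * y + x * \<alpha> y)"
    using assms unfolding generalized_twisted_field_def by metis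
  then show ?thesis
    by (intro has_component_of_rank_3I[of "\<lambda>z. z" 1 _ \<alpha> "\<lambda>y. y" "\<lambda>x. x" \<alpha> "\<lambda>_. 0" "\<lambda>_. 0"])
       (auto simp: additive_def)
qed

lemma coulter_matthews_ding_yuan_component:
  fixes star :: "'b::{field, finite} \<Rightarrow> 'b \<Rightarrow> 'b"
  assumes "coulter_matthews_ding_yuan star"
  shows "has_component_of_rank TYPE('b) 3 star"
proof -
  obtain c where "\<And>x y. star x y = x ^ 9 * y + x * (y ^ 9 - 2 * y) + (c * x ^ 3) * y ^ 3"
  proof -
    consider "star = (\<lambda>x y. x ^ 9 * y + x * y ^ 9 + 2 * x ^ 3 * y ^ 3 - 2 * x * y)"
      | "star = (\<lambda>x y. x ^ 9 * y + x * y ^ 9 - 2 * x ^ 3 * y ^ 3 - 2 * x * y)"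
      using assms by (auto simp: coulter_matthews_ding_yuan_def)
    then show ?thesis
    proof cases
      case 1 then show ?thesis by (intro that[of 2]) (simp add: algebra_simps)
    next
      case 2 then show ?thesis by (intro that[of "- 2"]) (simp add: algebra_simps)
    qed
  qed
  then show ?thesis
    by (intro has_component_of_rank_3I[of "\<lambda>z. z" 1]) (auto simp: additive_def)
qed

context field_of_order
begin

lemma two_nonzero: "odd p \<Longrightarrow> (2 :: 'a) \<noteq> 0"
  using CHAR_eq of_nat_eq_0_iff_char_dvd[where 'a='a, of 2] primes_dvd_imp_eq[OF prime two_is_prime_nat]
  by auto

lemma frob_two: "(2 :: 'a) ^ (p ^ i) = 2"
  using frob_add[of 1 1 i] by simp

lemma frob_involution:
  assumes "N = 2 * k"
  shows "((x :: 'a) ^ (p ^ k)) ^ (p ^ k) = x"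
proof -
  have "(x ^ (p ^ k)) ^ (p ^ k) = x ^ (p ^ (k + k))" by (simp only: power_add power_mult)
  also have "k + k = 0 + N * 1" using assms by simp
  finally show ?thesis unfolding frob_periodic by simp
qed

text \<open>
  In odd characteristic \<open>z \<mapsto> z + z ^ (p ^ i)\<close> is not the zero map, as it sends 1 to 2.
\<close>

lemma trace_component:
  assumes "odd p" "\<And>x y. star x y + star x y ^ (p ^ i) = f1 x * g1 y + f2 x * (g2 y :: 'a)"
  shows "has_component_of_rank TYPE('a) 3 star"
  by (rule has_component_of_rank_3I[of "\<lambda>z. z + z ^ (p ^ i)" 1 _ f1 g1 f2 g2 "\<lambda>_. 0" "\<lambda>_. 0"])
     (use assms two_nonzero in \<open>auto simp: additive_def frob_add\<close>)

end

text \<open>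
  The first two summands are the trace of \<open>x * y ^ (q ^ l)\<close> to the subfield of order \<open>q ^ l\<close>, while the
  rest is a trace times \<open>\<omega>\<close>, and \<open>\<omega>\<close> has trace zero.
\<close>

lemma budaghyan_helleseth_component:
  fixes star :: "'b::{field, finite} \<Rightarrow> 'b \<Rightarrow> 'b"
  assumes "budaghyan_helleseth star"
  shows "has_component_of_rank TYPE('b) 3 star"
proof -
  obtain q l d \<omega> \<beta> where q: "odd_prime_power q" "CARD('b) = q ^ (2 * l)" "\<omega> ^ (q ^ l) = - \<omega>"
    "star = (\<lambda>x y. x * y ^ (q ^ l) + x ^ (q ^ l) * y
                  + (\<beta> * (x * y ^ (q ^ d) + x ^ (q ^ d) * y)
                     + \<beta> ^ (q ^ l) * (x * y ^ (q ^ d) + x ^ (q ^ d) * y) ^ (q ^ l)) * \<omega>)"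
    using assms unfolding budaghyan_helleseth_def by blast
  obtain p a where p: "prime p" "odd p" "a > 0" "q = p ^ a" using q(1) by (rule odd_prime_powerE)
  interpret field_of_order "TYPE('b)" p "a * (2 * l)"
    by unfold_locales (use p q in \<open>auto simp: power_mult\<close>)
  define bar where "bar z = z ^ (p ^ (a * l))" for z :: 'b
  have bar_eq: "z ^ (q ^ l) = bar z" for z :: 'b by (simp add: bar_def p power_mult)
  have invol: "(x ^ p ^ (a * l)) ^ p ^ (a * l) = x" for x :: 'b
    by (rule frob_involution) simp
  have bar: "bar (x + y) = bar x + bar y" "bar (x * y) = bar x * bar y" "bar (bar x) = x" for x y
    by (simp_all add: bar_def frob_add power_mult_distrib invol)
  have "star x y + bar (star x y) = (2 * x) * bar y + (2 * bar x) * y" for x y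
    using q(3) by (simp add: q(4) bar_eq bar algebra_simps)
  then show ?thesis unfolding bar_def using p(2) by (intro trace_component)
qed

text \<open>
  All values of \<open>G\<close> are combinations, with coefficients 1 and -1, of Frobenius powers of
  \<open>x - x ^ (q ^ l)\<close>, whose conjugate is its negative.  So \<open>G\<close> has trace zero, and only the first summand
  survives in the trace.
\<close>

lemma P_semifield_component:
  fixes star :: "'b::{field, finite} \<Rightarrow> 'b \<Rightarrow> 'b"
  assumes "P_semifield star"
  shows "has_component_of_rank TYPE('b) 3 star"
proof -
  obtain q l k G where q: "odd_prime_power q" "CARD('b) = q ^ (2 * l)"
    and G: "G = (\<lambda>x :: 'b. (\<Sum>i=0..k. (-1) ^ i * (x - x ^ (q ^ l)) ^ (q ^ (2 * i)))
                     + (\<Sum>j=0..k-1. (-1) ^ (k + j) * (x - x ^ (q ^ l)) ^ (q ^ (2 * j + 1))))"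
    and star: "star = (\<lambda>x y. (1 / 2) * (x * y + x ^ (q ^ l) * y ^ (q ^ l))
                   + (1 / 4) * G (x * y ^ (q ^ 2) + x ^ (q ^ 2) * y))"
    using assms unfolding P_semifield_def Let_def by blast
  obtain p a where p: "prime p" "odd p" "a > 0" "q = p ^ a" using q(1) by (rule odd_prime_powerE)
  interpret field_of_order "TYPE('b)" p "a * (2 * l)"
    by unfold_locales (use p q in \<open>auto simp: power_mult\<close>)
  define bar where "bar z = z ^ (p ^ (a * l))" for z :: 'b
  have bar_eq: "z ^ (q ^ l) = bar z" for z :: 'b by (simp add: bar_def p power_mult)
  have invol: "(x ^ p ^ (a * l)) ^ p ^ (a * l) = x" for x :: 'b
    by (rule frob_involution) simp
  have bar_power: "bar (z ^ i) = bar z ^ i" for z i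
    by (simp add: bar_def mult.commute flip: power_mult)
  have bar: "bar (x + y) = bar x + bar y" "bar (x * y) = bar x * bar y" "bar (bar x) = x"
    "bar (x - y) = bar x - bar y" "bar (- x) = - bar x" "bar (x / y) = bar x / bar y"
    "bar 1 = 1" "bar (sum f A) = (\<Sum>i\<in>A. bar (f i))"
    for x y and f :: "nat \<Rightarrow> 'b" and A
    by (simp_all add: bar_def frob_add frob_diff frob_minus frob_sum power_divide power_mult_distrib invol)
  have bar2: "bar 2 = 2" "bar 4 = 4"
    using frob_two[of "a * l"] bar(2)[of 2 2] by (auto simp: bar_def)
  have "odd (q ^ i)" for i using p by simp
  then have odd: "(- z) ^ (q ^ i) = - (z ^ (q ^ i))" for z :: 'b and i by simp
  have anti: "bar (x - bar x) = - (x - bar x)" "bar (- 1) = - 1" for x by (simp_all add: bar)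
  have barG: "bar (G x) = - G x" for x
    by (simp only: G bar_eq bar(1,2,8) bar_power anti odd mult_minus_right sum_negf minus_add_distrib)
  have half: "1 / 2 + 1 / 2 = (1 :: 'b)"
    using two_nonzero[OF p(2)] by (simp flip: add_divide_distrib)
  have "star x y + bar (star x y) = x * y + bar x * bar y" for x y
  proof -
    let ?A = "x * y + bar x * bar y" and ?C = "G (x * y ^ (q ^ 2) + x ^ (q ^ 2) * y)"
    have "star x y = 1 / 2 * ?A + 1 / 4 * ?C" by (simp add: star bar_eq)
    moreover from this have "bar (star x y) = 1 / 2 * ?A - 1 / 4 * ?C"
      by (simp add: bar bar2 barG mult.commute add.commute)
    ultimately have "star x y + bar (star x y) = 1 / 2 * ?A + 1 / 2 * ?A" by simp
    then show ?thesis by (simp only: half mult_1_left flip: distrib_right)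
  qed
  then show ?thesis unfolding bar_def using p(2) by (intro trace_component)
qed

text \<open>
  For \<open>m = 1\<close> and \<open>n = 2\<close> the last two monomials of a Bierbrauer multiplication coincide.
\<close>

lemma bierbrauer_degree_one_component:
  fixes star :: "'b::{field, finite} \<Rightarrow> 'b \<Rightarrow> 'b"
  assumes "star = (\<lambda>x y. y ^ (q ^ 2) * x + y * x ^ (q ^ 2)
                  - v * (y ^ (q ^ 3) * x ^ (q ^ 3) + y ^ (q ^ 3) * x ^ (q ^ 3)))"
  shows "has_component_of_rank TYPE('b) 3 star"
  by (rule has_component_of_rank_3I[of "\<lambda>z. z" 1 _ "\<lambda>x. x" "\<lambda>y. y ^ (q ^ 2)"
          "\<lambda>x. x ^ (q ^ 2)" "\<lambda>y. y" "\<lambda>x. - 2 * v * x ^ (q ^ 3)" "\<lambda>y. y ^ (q ^ 3)"])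
     (auto simp: assms additive_def algebra_simps)

section \<open>Middle nuclei of Zha--Kyureghyan--Wang and Bierbrauer presemifields\<close>

context field_of_order
begin

text \<open>
  Comparing coefficients of \<open>y ^ (p ^ J)\<close> in \<open>B (f x) y = B x (g y)\<close>: the left-hand side contributes
  only if \<open>J\<close> is some \<open>j t\<close> modulo \<open>N\<close>.  If \<open>y ^ (p ^ k)\<close> occurs in \<open>g\<close>, then the right-hand side
  contributes for each \<open>J = k + j t\<close>, since its terms differ in their exponents at \<open>x\<close>.  So \<open>k\<close> is
  a period of the set of all \<open>j t\<close>, and \<open>k = 0\<close> is left.
\<close>

lemma sparse_middle_nucleus:
  fixes B :: "'a \<Rightarrow> 'a \<Rightarrow> 'a" and f g :: "'a \<Rightarrow> 'a" and R :: nat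
  assumes B: "\<And>x y. B x y = (\<Sum>t<R. w t * x ^ (p ^ i t) * y ^ (p ^ j t))"
  assumes w: "\<And>t. t < R \<Longrightarrow> w t \<noteq> 0"
  assumes i: "\<And>t t'. \<lbrakk>t < R; t' < R; [i t = i t'] (mod N)\<rbrakk> \<Longrightarrow> t = t'"
  assumes period: "\<And>k. (\<And>t. t < R \<Longrightarrow> \<exists>t'<R. [k + j t = j t'] (mod N)) \<Longrightarrow> [k = 0] (mod N)"
  assumes g: "additive g" and fg: "\<And>x y. B (f x) y = B x (g y)"
  shows "\<exists>d. \<forall>y. g y = d * y"
proof -
  obtain c where c: "\<And>z. g z = (\<Sum>e<N. c e * z ^ (p ^ e))"
    using additive_linearized[OF g] by blast
  have "[k = 0] (mod N)" if k: "k < N" "c k \<noteq> 0" for k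
  proof (rule period, rule ccontr)
    fix t assume t: "t < R" and no: "\<not> (\<exists>t'<R. [k + j t = j t'] (mod N))"
    define J where "J = k + j t"
    have "frob_coeff J (\<lambda>y. B (f x) y) = 0" for x
      unfolding B using no by (simp add: frob_coeff_sum frob_coeff_term J_def)
    then have "frob_coeff (i t) (\<lambda>x. frob_coeff J (\<lambda>y. B x (g y))) = frob_coeff (i t) (\<lambda>x. 0)"
      by (simp add: fg)
    also have "\<dots> = 0" by (simp add: frob_coeff_def)
    also have "B x (g y) = (\<Sum>s<R. \<Sum>e<N. (w s * c e ^ (p ^ j s) * x ^ (p ^ i s)) * y ^ (p ^ (e + j s)))" for x y
      by (simp add: B c frob_sum power_mult_distrib sum_distrib_left power_add mult_ac flip: power_mult)
    then have "frob_coeff J (\<lambda>y. B x (g y)) =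
      (\<Sum>s<R. \<Sum>e<N. (if [J = e + j s] (mod N) then w s * c e ^ (p ^ j s) else 0) * x ^ (p ^ i s))" for x
      by (simp only: frob_coeff_sum frob_coeff_term) (intro sum.cong refl, auto)
    then have "frob_coeff (i t) (\<lambda>x. frob_coeff J (\<lambda>y. B x (g y))) =
      (\<Sum>s<R. \<Sum>e<N. if [i t = i s] (mod N) then if [J = e + j s] (mod N) then w s * c e ^ (p ^ j s) else 0 else 0)"
      by (simp only: frob_coeff_sum frob_coeff_term)
    also have "\<dots> = (\<Sum>s<R. if s = t then \<Sum>e<N. if e = k then w t * c k ^ (p ^ j t) else 0 else 0)"
    proof (intro sum.cong refl)
      fix s assume s: "s \<in> {..<R}"
      have "[k + j t = e + j t] (mod N) \<longleftrightarrow> e = k" if "e < N" for e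
        unfolding cong_add_rcancel_nat using that k by (auto simp: cong_def)
      then show "(\<Sum>e<N. if [i t = i s] (mod N) then if [J = e + j s] (mod N) then w s * c e ^ (p ^ j s) else 0 else 0) =
          (if s = t then \<Sum>e<N. if e = k then w t * c k ^ (p ^ j t) else 0 else 0)"
        using i[of t s] s t by (auto simp: J_def intro!: sum.cong sum.neutral)
    qed
    also have "\<dots> = w t * c k ^ (p ^ j t)"
      using t k by simp
    finally show False using w[OF t] k by (simp add: frob_eq_0_iff)
  qed
  then have zero: "c k = 0" if "k \<noteq> 0" "k < N" for k using that by (auto simp: cong_def)
  have "g y = c 0 * y" for y
  proof -
    have "g y = (\<Sum>e<N. if e = 0 then c 0 * y else 0)"
      unfolding c by (intro sum.cong refl) (use zero in auto)
    then show ?thesis using N_pos by simp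
  qed
  then show ?thesis by blast
qed

text \<open>
  The exponents of Frobenius powers that fix \<open>d\<close> are closed under addition and subtraction.
\<close>

lemma frob_gcd_fixed:
  assumes "(d :: 'a) ^ (p ^ i) = d" "d ^ (p ^ j) = d"
  shows "d ^ (p ^ gcd i j) = d"
proof -
  have mult: "d ^ (p ^ (i * k)) = d" if "d ^ (p ^ i) = d" for i k
    by (induction k) (use that in \<open>simp_all add: power_add power_mult\<close>)
  have add: "d ^ (p ^ (a + b)) = d ^ (p ^ b)" if "d ^ (p ^ a) = d" for a b
    using that by (simp add: power_add power_mult)
  have *: "d ^ (p ^ gcd i j) = d" if "i * x - j * y = gcd i j" "j * y \<le> i * x"
    "d ^ (p ^ i) = d" "d ^ (p ^ j) = d" for i j x y
  proof -
    have "i * x = j * y + gcd i j" using that by simp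
    then show ?thesis using mult[OF that(3), of x] add[OF mult[OF that(4), of y], of "gcd i j"] by simp
  qed
  show ?thesis
    using bezout_gcd_nat'[of i j] *[of i _ j] *[of j _ i] assms by (metis gcd.commute)
qed

end

text \<open>
  The powers \<open>u ^ (i * m)\<close> with \<open>m = (r ^ k - 1) / (r - 1)\<close> and zero provide \<open>r\<close> solutions; there are no
  more, since they are roots of \<open>X ^ r - X\<close>.
\<close>

lemma card_subfield:
  fixes r :: nat
  assumes "r > 1" "CARD('a::{field, finite}) = r ^ k"
  shows "card {x :: 'a. x ^ r = x} = r"
proof -
  have k: "k > 0" using assms card_field_ge_2[where 'a='a] by (cases k) auto
  obtain u :: 'a where u: "primitive_element u" using ex_primitive_element by blast
  then have u0: "u \<noteq> 0" by (rule primitive_element_nonzero)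
  have "(r - 1) dvd (r ^ k - 1)"
  proof (rule cong_to_1_nat)
    have "[r = 1] (mod (r - 1))" using assms(1) by (simp add: cong_altdef_nat)
    then show "[r ^ k = 1] (mod (r - 1))" using cong_pow by fastforce
  qed
  then obtain m where m: "r ^ k - 1 = (r - 1) * m" by blast
  have "r ^ k > 1" using assms(1) k by (rule one_less_power)
  then have m0: "m > 0" using m by (cases m) auto
  have inj: "inj_on (\<lambda>i. u ^ (i * m)) {..<r - 1}"
  proof (rule linorder_inj_onI')
    fix i j assume ij: "i \<in> {..<r - 1}" "j \<in> {..<r - 1}" "i < j"
    have "u ^ ((j - i) * m) \<noteq> 1"
    proof (rule primitive_element_power_ne_1[OF u])
      show "0 < (j - i) * m" using ij m0 by simp
      have "(j - i) * m < (r - 1) * m" using ij m0 by (intro mult_strict_right_mono) auto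
      then show "(j - i) * m < CARD('a) - 1" using m assms by simp
    qed
    moreover have "u ^ (j * m) = u ^ (i * m) * u ^ ((j - i) * m)"
      using ij by (simp add: diff_mult_distrib flip: power_add)
    ultimately show "u ^ (i * m) \<noteq> u ^ (j * m)" using u0 by simp
  qed
  let ?S = "insert 0 ((\<lambda>i. u ^ (i * m)) ` {..<r - 1})"
  have "card ?S = r"
    using u0 assms(1) inj by (subst card_insert_disjoint) (auto simp: card_image)
  moreover have "?S \<subseteq> {x. x ^ r = x}"
  proof safe
    fix i
    have "(u ^ (i * m)) ^ (r - 1) = (u ^ (CARD('a) - 1)) ^ i"
      using m assms by (simp add: mult_ac flip: power_mult)
    then have "(u ^ (i * m)) ^ (r - 1) = 1" using power_card_minus_one[OF u0] by simp
    then have "(u ^ (i * m)) ^ (Suc (r - 1)) = u ^ (i * m)" by simp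
    then show "(u ^ (i * m)) ^ r = u ^ (i * m)" using assms(1) by simp
  qed (use assms in auto)
  ultimately have "r \<le> card {x :: 'a. x ^ r = x}" by (metis card_mono finite)
  moreover have "card {x :: 'a. x ^ r = x} \<le> r"
  proof -
    define P where "P = (monom 1 r - monom 1 1 :: 'a poly)"
    have "coeff P r = 1" using assms(1) by (simp add: P_def)
    then have "P \<noteq> 0" by auto
    then have "card {x. poly P x = 0} \<le> degree P" by (rule card_poly_roots_bound)
    also have "degree P \<le> r"
      unfolding P_def using assms(1) by (intro degree_diff_le) (auto simp: degree_monom_eq)
    also have "{x. poly P x = 0} = {x. x ^ r = x}" by (simp add: P_def poly_monom)
    finally show ?thesis .
  qed
  ultimately show ?thesis by simp
qed

text \<open>
  A period of the exponents is, up to the factor \<open>a\<close>, one of them.  It cannot be \<open>n\<close> modulo \<open>m\<close>,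
  because then \<open>2 * n\<close> would be \<open>0\<close> or \<open>n\<close> modulo \<open>m\<close>.  It cannot be \<open>c * m\<close>, because \<open>2 * c\<close> is neither
  \<open>0\<close> nor \<open>c\<close> modulo \<open>c + 1\<close>.
\<close>

lemma four_term_exponents_period:
  fixes m n c k a :: nat
  defines "ey \<equiv> (\<lambda>t. [n, 0, m + n, c * m] ! t)"
  assumes m: "odd m" "m > 1" "coprime m n" and c: "c = 2 \<or> c = 3" and a: "a > 0"
    and per: "\<And>t. t < 4 \<Longrightarrow> \<exists>t'<4. [k + a * ey t = a * ey t'] (mod a * ((c + 1) * m))"
  shows "[k = 0] (mod a * ((c + 1) * m))"
proof -
  let ?L = "(c + 1) * m"
  have val: "\<exists>e\<in>{0, n, m + n, c * m}. [k + a * d = a * e] (mod a * ?L)" if "d \<in> {0, n, m + n, c * m}" for d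
  proof -
    have "d \<in> ey ` {1, 0, 2, 3}" using that by (simp add: ey_def)
    then obtain t where "t \<in> {1, 0, 2, 3}" and ey_t: "ey t = d" by blast
    then have t: "t < 4" "ey t = d" by auto
    obtain t' where t': "t' < 4" "[k + a * d = a * ey t'] (mod a * ?L)" using per[OF t(1)] t(2) by blast
    have "t' = 0 \<or> t' = 1 \<or> t' = 2 \<or> t' = 3" using t'(1) by auto
    then have "ey t' \<in> {0, n, m + n, c * m}" by (auto simp: ey_def)
    with t'(2) show ?thesis by blast
  qed
  obtain e where e: "e \<in> {0, n, m + n, c * m}" "[k = a * e] (mod a * ?L)"
    using val[of 0] unfolding mult_0_right add_0_right by blast
  have step: "\<exists>f\<in>{0, n, m + n, c * m}. [e + d = f] (mod ?L)" if d: "d \<in> {0, n, m + n, c * m}" for d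
  proof -
    obtain f where f: "f \<in> {0, n, m + n, c * m}" "[k + a * d = a * f] (mod a * ?L)" using val[OF d] by blast
    have "[a * (e + d) = a * f] (mod a * ?L)"
      unfolding distrib_left
      using cong_trans[OF cong_add[OF cong_sym[OF e(2)] cong_refl[of "a * d"]] f(2)] .
    then have "[e + d = f] (mod ?L)" by (simp only: cong_mult_modulus[OF a])
    with f show ?thesis by blast
  qed
  have nd: "\<not> m dvd n" "\<not> m dvd 2 * n" using odd_coprime_not_dvd_double[OF m] by auto
  have "\<not> [e = n] (mod m)"
  proof
    assume en: "[e = n] (mod m)"
    obtain f where f: "f \<in> {0, n, m + n, c * m}" "[e + n = f] (mod ?L)" using step[of n] by blast
    from f(2) have "[e + n = f] (mod m)" by (rule cong_dvd_modulus_nat) simp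
    then have "[n + n = f] (mod m)"
      using cong_add[OF en cong_refl[of n]] cong_trans cong_sym by blast
    moreover have "[f = 0] (mod m) \<or> [f = n] (mod m)" using f(1) by (auto simp: cong_def)
    ultimately have "[n + n = 0] (mod m) \<or> [n + n = n + 0] (mod m)" using cong_trans by auto
    then have "[2 * n = 0] (mod m) \<or> [n = 0] (mod m)" unfolding cong_add_lcancel_nat by (simp add: mult_2)
    then show False using nd by (simp add: cong_0_iff)
  qed
  then have "e = 0 \<or> e = c * m" using e(1) by (auto simp: cong_def)
  moreover have "e \<noteq> c * m"
  proof
    assume em: "e = c * m"
    obtain f where f: "f \<in> {0, n, m + n, c * m}" "[c * m + c * m = f] (mod ?L)" using step[of "c * m"] unfolding em by blast
    from f(2) have "[c * m + c * m = f] (mod m)" by (rule cong_dvd_modulus_nat) simp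
    then have "[f = 0] (mod m)" by (metis cong_0_iff cong_sym cong_trans dvd_add dvd_triv_right)
    moreover have "\<not> [n = 0] (mod m)" "\<not> [m + n = 0] (mod m)" using nd by (auto simp: cong_0_iff)
    ultimately have "f = 0 \<or> f = c * m" using f(1) by auto
    moreover have mult: "c * m + c * m = m * (c + c)" "(c + 1) * m = m * (c + 1)" "c * m = m * c"
      by (simp_all add: algebra_simps)
    ultimately have "f = m * 0 \<or> f = m * c" by (simp only: mult_0_right)
    moreover have "[m * (c + c) = f] (mod m * (c + 1))" using f(2) unfolding mult(1,2) .
    ultimately have "[m * (c + c) = m * 0] (mod m * (c + 1)) \<or> [m * (c + c) = m * c] (mod m * (c + 1))"
      by blast
    then have "[c + c = 0] (mod c + 1) \<or> [c + c = c] (mod c + 1)"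
      using m(2) by (simp only: cong_mult_modulus[of m])
    then show False using c by (auto simp: cong_def)
  qed
  ultimately have "e = 0" by blast
  then show ?thesis using e(2) by simp
qed

text \<open>
  For \<open>c = 2\<close> this is the Zha--Kyureghyan--Wang family, for \<open>c = 3\<close> the Bierbrauer family.  By
  \<open>sparse_middle_nucleus\<close> the middle nucleus consists of multiplications by elements \<open>d\<close>.
  Comparing the remaining coefficients shows that \<open>d\<close> is fixed by the Frobenius powers
  of exponents \<open>2 * n\<close> and \<open>(c - 1) * m\<close> over the field with \<open>q\<close> elements, so it lies in the subfield
  of order \<open>q ^ (c - 1)\<close>.  Conversely, all elements of that subfield qualify.
\<close>

theorem four_term_middle_nucleus:
  fixes star :: "'a::{field, finite} \<Rightarrow> 'a \<Rightarrow> 'a"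
  assumes q: "odd_prime_power q" "CARD('a) = q ^ ((c + 1) * m)"
    and m: "odd m" "m > 1" "coprime m n" and c: "c = 2 \<or> c = 3 \<and> even n" and v: "v \<noteq> 0"
    and star: "star = (\<lambda>x y. y ^ (q ^ n) * x + y * x ^ (q ^ n)
                  - v * (y ^ (q ^ (m + n)) * x ^ (q ^ (c * m))
                         + y ^ (q ^ (c * m)) * x ^ (q ^ (m + n))))"
  shows "card (middle_nucleus star) = q ^ (c - 1)"
proof -
  obtain p a where p: "prime p" "odd p" "a > 0" "q = p ^ a" using q(1) by (rule odd_prime_powerE)
  define L where "L = (c + 1) * m"
  interpret field_of_order "TYPE('a)" p "a * L"
    by unfold_locales (use p q in \<open>auto simp: power_mult L_def\<close>)
  have c': "c = 2 \<or> c = 3" using c by auto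
  have nd: "\<not> m dvd n" "\<not> m dvd 2 * n" using odd_coprime_not_dvd_double[OF m] by auto
  define w where "w t = [1, 1, - v, - v] ! t" for t
  define ex where "ex = (\<lambda>t. [0, n, c * m, m + n] ! t)"
  define ey where "ey = (\<lambda>t. [n, 0, m + n, c * m] ! t)"
  have four: "{..<4::nat} = {0, 1, 2, 3}" by auto
  have star4: "star x y = (\<Sum>t<4. w t * x ^ p ^ (a * ex t) * y ^ p ^ (a * ey t))" for x y
    by (simp add: four star w_def ex_def ey_def p(4) algebra_simps flip: power_mult)
  have w: "w t \<noteq> 0" if "t < 4" for t
    using that v less_Suc_eq by (auto simp: w_def four numeral_eq_Suc)
  have ex_inj: "t = t'" if t: "t < 4" "t' < 4" and "[a * ex t = a * ex t'] (mod a * L)" for t t'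
  proof -
    have cong: "[ex t = ex t'] (mod L)" using that(3) by (simp only: cong_mult_modulus[OF p(3)])
    then have "[ex t = ex t'] (mod m)" by (rule cong_dvd_modulus_nat) (simp add: L_def)
    moreover have "\<not> [n = 0] (mod m)" using nd by (simp add: cong_0_iff)
    moreover have "\<not> [c * m = 0] (mod L)" "\<not> [m + n = n] (mod L)"
      using m(2) c' by (auto simp: L_def cong_0_iff cong_add_rcancel_0_nat nat_dvd_not_less)
    moreover have cases: "t = 0 \<or> t = 1 \<or> t = 2 \<or> t = 3" "t' = 0 \<or> t' = 1 \<or> t' = 2 \<or> t' = 3" using t by auto
    ultimately show ?thesis using cong by (auto simp: ex_def cong_def)
  qed
  let ?K = "{d :: 'a. d ^ (q ^ (c - 1)) = d}"
  have "middle_nucleus star = (\<lambda>d y. d * y) ` ?K"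
  proof (intro equalityI subsetI)
    fix g assume "g \<in> middle_nucleus star"
    then obtain f where g: "additive g" "\<And>x y. star (f x) y = star x (g y)"
      by (auto simp: middle_nucleus_def)
    have "\<exists>d. \<forall>y. g y = d * y"
    proof (rule sparse_middle_nucleus[OF star4 w ex_inj _ g])
      fix k assume "\<And>t. t < 4 \<Longrightarrow> \<exists>t'<4. [k + a * ey t = a * ey t'] (mod a * L)"
      then show "[k = 0] (mod a * L)"
        unfolding L_def ey_def by (rule four_term_exponents_period[OF m c' p(3)])
    qed
    then obtain d where d: "\<And>y. g y = d * y" by blast
    have eq: "f x ^ p ^ (a * ex t) = x ^ p ^ (a * ex t) * d ^ p ^ (a * ey t)" if t: "t < 4" for x t
    proof -
      have ey_inj: "[a * ey t = a * ey s] (mod a * L) \<longleftrightarrow> s = t" if "s < 4" for s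
      proof
        assume cong: "[a * ey t = a * ey s] (mod a * L)"
        \<comment> \<open>the exponents at \<open>y\<close> are a permutation of those at \<open>x\<close>\<close>
        define \<tau> where "\<tau> r = [1, 0, 3, 2 :: nat] ! r" for r
        have cases: "t = 0 \<or> t = 1 \<or> t = 2 \<or> t = 3" "s = 0 \<or> s = 1 \<or> s = 2 \<or> s = 3"
          using t that by auto
        then have \<tau>: "ey t = ex (\<tau> t)" "ey s = ex (\<tau> s)" "\<tau> t < 4" "\<tau> s < 4"
          by (auto simp: \<tau>_def ex_def ey_def)
        then have "\<tau> t = \<tau> s" using ex_inj cong by metis
        then show "s = t" using cases by (auto simp: \<tau>_def)
      qed auto
      have "frob_coeff (a * ey t) (\<lambda>y. star (f x) y) = w t * f x ^ p ^ (a * ex t)"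
        unfolding star4 using t by (simp add: frob_coeff_sum frob_coeff_term ey_inj cong: sum.cong_simp)
      moreover have "star x (g y) = (\<Sum>s<4. (w s * x ^ p ^ (a * ex s) * d ^ p ^ (a * ey s)) * y ^ p ^ (a * ey s))" for y
        by (simp add: star4 d power_mult_distrib mult_ac)
      then have "frob_coeff (a * ey t) (\<lambda>y. star x (g y)) = w t * x ^ p ^ (a * ex t) * d ^ p ^ (a * ey t)"
        using t by (simp add: frob_coeff_sum frob_coeff_term ey_inj cong: sum.cong_simp)
      ultimately show ?thesis using g(2) w[OF t] by simp
    qed
    have f1: "f 1 = d ^ p ^ (a * n)" using eq[of 0 1] by (simp add: ex_def ey_def)
    have "(d ^ p ^ (a * n)) ^ p ^ (a * n) = d"
      using eq[of 1 1] by (simp add: ex_def ey_def f1)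
    then have "d ^ p ^ (a * n + a * n) = d" by (simp only: power_add power_mult)
    then have "d ^ p ^ (a * (2 * n)) = d" by (simp only: mult_2 distrib_left)
    moreover have "d ^ p ^ (a * ((c - 1) * m)) = d"
    proof -
      have e: "a * n + a * (c * m) = a * ((c - 1) * m) + a * (m + n)"
        using c' by (auto simp: algebra_simps)
      have "(d ^ p ^ (a * n)) ^ p ^ (a * (c * m)) = d ^ p ^ (a * (m + n))"
        using eq[of 2 1] by (simp add: ex_def ey_def f1)
      then have "d ^ p ^ (a * n + a * (c * m)) = d ^ p ^ (a * (m + n))"
        by (simp only: power_add power_mult)
      then have "(d ^ p ^ (a * ((c - 1) * m))) ^ p ^ (a * (m + n)) = d ^ p ^ (a * (m + n))"
        unfolding e by (simp only: power_add power_mult)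
      then show ?thesis by (simp only: frob_inj)
    qed
    ultimately have "d ^ p ^ gcd (a * (2 * n)) (a * ((c - 1) * m)) = d" by (rule frob_gcd_fixed)
    moreover have "gcd (2 * n) ((c - 1) * m) = c - 1"
    proof -
      have "coprime (2 * n) m" "coprime n m" using m by (simp_all add: coprime_commute)
      then have "gcd (2 * n) m = 1" "gcd (2 * n) (2 * m) = 2"
        using gcd_mult_distrib_nat[of 2 n m] by (simp_all add: coprime_imp_gcd_eq_1)
      then show ?thesis using c' by auto
    qed
    ultimately have "d ^ (q ^ (c - 1)) = d" by (simp add: p(4) flip: gcd_mult_distrib_nat power_mult)
    then show "g \<in> (\<lambda>d y. d * y) ` ?K" using d by (intro image_eqI[of _ _ d]) auto
  next
    fix g assume "g \<in> (\<lambda>d y. d * y) ` ?K"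
    then obtain d where g: "g = (\<lambda>y. d * y)" and d: "d ^ (q ^ (c - 1)) = d" by blast
    have fixed: "d ^ (q ^ ((c - 1) * k)) = d" for k
      by (induction k) (use d in \<open>simp_all add: power_add power_mult\<close>)
    have dn: "d ^ (q ^ n) = d"
    proof -
      have "(c - 1) dvd n" using c by auto
      then show ?thesis using fixed by (auto elim!: dvdE)
    qed
    have "d ^ (q ^ (c * m)) = d ^ (q ^ m)"
    proof -
      have "c * m = (c - 1) * m + m" using c' by auto
      then have "q ^ (c * m) = q ^ ((c - 1) * m) * q ^ m" by (simp only: power_add)
      then show ?thesis using fixed[of m] by (simp add: power_mult)
    qed
    moreover have "d ^ (q ^ (m + n)) = d ^ (q ^ m)"
    proof -
      have "q ^ (m + n) = q ^ n * q ^ m" by (simp add: power_add)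
      then show ?thesis using dn by (simp only: power_mult)
    qed
    ultimately have "star (d * x) y = star x (g y)" for x y
      using dn by (simp add: g star power_mult_distrib algebra_simps)
    then show "g \<in> middle_nucleus star"
      unfolding middle_nucleus_def
      by (intro CollectI conjI exI[of _ "\<lambda>x. d * x"]) (simp_all add: additive_def g distrib_left)
  qed
  moreover have "inj_on (\<lambda>d y. d * y :: 'a) ?K" by (rule inj_onI, drule fun_cong[of _ _ 1]) simp
  ultimately have "card (middle_nucleus star) = card ?K" by (simp add: card_image)
  moreover have "card ?K = q ^ (c - 1)"
  proof (rule card_subfield)
    have "q > 1" unfolding p(4) using p_gt_1 p(3) by (rule one_less_power)
    then show "q ^ (c - 1) > 1" by (rule one_less_power) (use c' in auto)
    have "(c - 1) dvd (c + 1)" using c' by auto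
    then have "(c - 1) dvd L" unfolding L_def by (rule dvd_mult2)
    then have "(c - 1) * (L div (c - 1)) = L" by (rule dvd_mult_div_cancel)
    then have "(q ^ (c - 1)) ^ (L div (c - 1)) = q ^ L" using power_mult by metis
    then show "CARD('a) = (q ^ (c - 1)) ^ (L div (c - 1))" unfolding q(2) L_def ..
  qed
  ultimately show ?thesis by simp
qed

section \<open>Zha--Kyureghyan--Wang presemifields of order \<open>q ^ 3\<close>\<close>

lemma has_characteristic_CHAR:
  "has_characteristic TYPE('a::{field, finite}) CHAR('a)"
proof -
  have "nat_scale n x = of_nat n * x" for n and x :: 'a
    by (induction n) (auto simp: nat_scale_def algebra_simps)
  then show ?thesis
    unfolding has_characteristic_def
    by (auto simp: prime_CHAR_semidom finite_imp_CHAR_pos intro: exI[of _ 1])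
qed

lemma additive_prime_field_linear: "additive g \<Longrightarrow> prime_field_linear p g"
  by (auto simp: prime_field_linear_def nat_scale_def additive.add additive.sum)

lemma additive_inj_imp_bij:
  fixes g :: "'a::{finite, ab_group_add} \<Rightarrow> 'a"
  assumes "additive g" "\<And>x. g x = 0 \<Longrightarrow> x = 0"
  shows "bij g"
proof -
  have "x = y" if "g x = g y" for x y
    using assms(2)[of "x - y"] additive.diff[OF assms(1), of x y] that by simp
  then show ?thesis by (simp add: bij_def finite_UNIV_inj_surj inj_def)
qed

text \<open>
  Additive maps are linear over the prime field, and on a finite group injectivity suffices.
\<close>

lemma isotopicI:
  fixes star star' :: "'a::{field, finite} \<Rightarrow> 'a \<Rightarrow> 'a"
  assumes "additive g1" "\<And>x. g1 x = 0 \<Longrightarrow> x = 0" "additive g2" "\<And>x. g2 x = 0 \<Longrightarrow> x = 0"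
    "additive g3" "\<And>x. g3 x = 0 \<Longrightarrow> x = 0" "\<And>x y. star' (g1 x) (g2 y) = g3 (star x y)"
  shows "isotopic star star'"
  unfolding isotopic_def
  using has_characteristic_CHAR[where 'a='a] assms additive_prime_field_linear additive_inj_imp_bij
  by meson

text \<open>
  Here \<open>x\<close>, \<open>x1\<close>, \<open>x2\<close> stand for an element of a cubic extension and its conjugates.  For a
  substitution \<open>a0 * x + a1 * x1 + a2 * x2\<close> with coefficients in the base field to turn the twisted
  field multiplication into a combination of \<open>x * y1 + x1 * y - 2 * \<zeta> * (x2 * y2)\<close> and its conjugates,
  one needs \<open>a0\<^sup>2 = \<zeta> * a1 * a2\<close>, \<open>a1\<^sup>2 = \<zeta> * a0 * a2\<close> and \<open>a2\<^sup>2 = \<zeta> * a0 * a1\<close>.  These equations are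
  solved by \<open>1, \<zeta>, \<zeta>\<close>.
\<close>

lemma cubic_twisted_identity:
  fixes \<zeta> x x1 x2 y y1 y2 :: "'a::field"
  assumes "\<zeta>\<^sup>2 + \<zeta> + 1 = 0"
  shows "(x1 + \<zeta> * (x2 + x)) * (y + \<zeta> * (y1 + y2)) + (x + \<zeta> * (x1 + x2)) * (y1 + \<zeta> * (y2 + y)) =
     - (\<zeta> * (x * y1 + x1 * y - 2 * \<zeta> * (x2 * y2))
        + (x1 * y2 + x2 * y1 - 2 * \<zeta> * (x * y)) + (x2 * y + x * y2 - 2 * \<zeta> * (x1 * y1)))"
    (is "?l = ?r")
proof -
  have "?l - ?r = (\<zeta>\<^sup>2 + \<zeta> + 1) * (x * y1 + x1 * y + x1 * y2 + x2 * y1 + x2 * y + x * y2)"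
    by (simp add: algebra_simps power2_eq_square)
  then show ?thesis using assms by simp
qed

text \<open>
  The conditions on \<open>n\<close> leave \<open>n = 2\<close>, and \<open>n = 1\<close> with \<open>q \<equiv> 1\<close> modulo 3.  In the second case \<open>v\<close> is a
  cube \<open>w ^ 3\<close>, and the norm \<open>\<zeta>\<close> of \<open>w\<close> is a primitive cube root of unity.
\<close>

theorem zkw_cubic_isotopic_twisted_field:
  fixes star :: "'a::{field, finite} \<Rightarrow> 'a \<Rightarrow> 'a"
  assumes zkw: "zha_kyureghyan_wang q 1 star"
  shows "\<exists>star' :: 'a \<Rightarrow> 'a \<Rightarrow> 'a. generalized_twisted_field star' \<and> isotopic star star'"
proof -
  from zkw obtain n u v where z': "odd_prime_power q" "CARD('a) = q ^ 3" "0 < n" "n < 3"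
    "primitive_element u" "v = u ^ (q - 1)" "[1 + n = 0] (mod 3) \<or> [q = 1] (mod 3)"
    "star = (\<lambda>x y. y ^ (q ^ n) * x + y * x ^ (q ^ n)
                  - v * (y ^ (q ^ (1 + n)) * x ^ (q ^ 2) + y ^ (q ^ 2) * x ^ (q ^ (1 + n))))"
    unfolding zha_kyureghyan_wang_def mult_1_right power_one_right by blast
  have n12: "n = 1 \<or> n = 2" using z'(3,4) by auto
  note z = z'(1,2) n12 z'(5-)
  obtain p a where p: "prime p" "odd p" "a > 0" "q = p ^ a" using z(1) by (rule odd_prime_powerE)
  interpret field_of_order "TYPE('a)" p "a * 3"
    by unfold_locales (use p z in \<open>auto simp: power_mult\<close>)
  define \<sigma> where "\<sigma> x = x ^ q" for x :: 'a
  have \<sigma>: "\<sigma> (x + y) = \<sigma> x + \<sigma> y" "\<sigma> (x - y) = \<sigma> x - \<sigma> y" "\<sigma> (- x) = - \<sigma> x"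
    "\<sigma> (x * y) = \<sigma> x * \<sigma> y" "\<sigma> 0 = 0" "\<sigma> 1 = 1" "\<sigma> 2 = 2" for x y
    using frob_two[of a]
    by (simp_all add: \<sigma>_def p frob_add frob_diff frob_minus power_mult_distrib zero_power prime_gt_0_nat[OF prime])
  have \<sigma>3: "\<sigma> (\<sigma> (\<sigma> x)) = x" for x
    using power_card_eq_self[of x] by (simp add: \<sigma>_def z(2) power3_eq_cube mult.assoc flip: power_mult)
  have pow: "x ^ q = \<sigma> x" "x ^ (q ^ 2) = \<sigma> (\<sigma> x)" "x ^ (q ^ 3) = x" for x
    using \<sigma>3[of x] by (simp_all add: \<sigma>_def power2_eq_square power3_eq_cube power_mult)
  have \<sigma>0: "\<sigma> x = 0 \<longleftrightarrow> x = 0" for x using p_gt_1 by (simp add: \<sigma>_def p)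
  have q: "q \<ge> 3"
    using z(1) by (cases "q = 0 \<or> q = 1 \<or> q = 2") (auto simp: odd_prime_power_def)
  have q3: "q ^ 3 = q * q * q" by (simp add: power3_eq_cube)
  have q3': "3 * q < q ^ 3"
  proof -
    have "3 * 3 \<le> q * q" using q by (intro mult_mono) auto
    then have "(3 * 3) * q \<le> q * q * q" by (intro mult_right_mono) auto
    then show ?thesis using q by (simp add: q3)
  qed
  have gtf: "generalized_twisted_field (\<lambda>x y. x ^ (q ^ k) * y + x * (y :: 'a) ^ (q ^ k))" if "k = 1 \<or> k = 2" for k
    unfolding generalized_twisted_field_def
  proof (rule exI[of _ q], rule exI[of _ "3::nat"], rule exI[of _ k],
      rule exI[of _ "\<lambda>x. x ^ (q ^ k)"], intro conjI)
    show "{x :: 'a. x ^ (q ^ k) = x} = subfield_of_order q"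
      using that pow \<sigma>3 by (auto simp: subfield_of_order_def) metis+
    show "odd (3 div gcd 3 k)" using that by (auto simp: gcd_non_0_nat)
  qed (use z in auto)
  show ?thesis
  proof (cases "n = 2")
    case True
    have "v \<noteq> 1"
      using primitive_element_power_ne_1[OF z(4), of "q - 1"] q q3' z(2,5) by simp
    have pow': "x ^ (q * (q * q)) = x" for x :: 'a using pow(3)[of x] by (simp add: q3 mult.assoc)
    have star: "star x y = (1 - v) * (\<sigma> (\<sigma> x) * y + x * \<sigma> (\<sigma> y))" for x y
      using True by (simp add: z(7) pow pow' algebra_simps)
    have "isotopic star (\<lambda>x y :: 'a. x ^ (q ^ 2) * y + x * y ^ (q ^ 2))"
    proof (rule isotopicI[of "\<lambda>x. x" "\<lambda>x. x" "\<lambda>z. inverse (1 - v) * z"])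
      show "additive (\<lambda>z. inverse (1 - v) * z)" by (simp add: additive_def distrib_left)
    qed (use \<open>v \<noteq> 1\<close> in \<open>auto simp: additive_def pow star\<close>)
    then show ?thesis using gtf[of 2] by blast
  next
    case False
    then have n: "n = 1" and "[q = 1] (mod 3)" using z(3,6) by (auto simp: cong_def)
    then have "q mod 3 = 1" by (simp add: cong_def)
    then have m: "q = 3 * (q div 3) + 1" by presburger
    define m where "m = q div 3"
    note m = m[folded m_def]
    have star: "star x y = x * \<sigma> y + \<sigma> x * y - 2 * v * (\<sigma> (\<sigma> x) * \<sigma> (\<sigma> y))" for x y
      by (simp add: z(7) n pow numeral_2_eq_2[symmetric] algebra_simps)
    define w where "w = u ^ m"
    have v: "v = w ^ 3" using m by (simp add: w_def z(5) flip: power_mult)  (simp add: mult.commute)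
    have w0: "w \<noteq> 0" using primitive_element_nonzero[OF z(4)] by (simp add: w_def)
    define \<zeta> where "\<zeta> = w * \<sigma> w * \<sigma> (\<sigma> w)"
    have \<zeta>_eq: "\<zeta> = u ^ (m * (1 + q + q * q))"
      by (simp add: \<zeta>_def w_def \<sigma>_def power_add distrib_left mult.assoc flip: power_mult)
    have \<sigma>\<zeta>: "\<sigma> \<zeta> = \<zeta>" by (simp add: \<zeta>_def \<sigma> \<sigma>3 mult_ac)
    have exp: "3 * (m * (1 + q + q * q)) = CARD('a) - 1"
    proof -
      have "q * q * q = 3 * (m * (1 + q + q * q)) + 1" unfolding m by (simp add: algebra_simps)
      then show ?thesis by (simp add: z(2) q3)
    qed
    have "m > 0" using q m by simp
    then have "0 < m * (1 + q + q * q)" by simp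
    then have "\<zeta> \<noteq> 1"
      unfolding \<zeta>_eq using exp by (intro primitive_element_power_ne_1[OF z(4)]) linarith+
    have "\<zeta> ^ 3 = u ^ (CARD('a) - 1)"
      unfolding \<zeta>_eq exp[symmetric] mult.commute[of 3] by (rule power_mult[symmetric])
    also have "\<dots> = 1" using primitive_element_nonzero[OF z(4)] by (rule power_card_minus_one)
    finally have \<zeta>_cube: "\<zeta> ^ 3 = 1" .
    then have "(\<zeta> - 1) * (\<zeta>\<^sup>2 + \<zeta> + 1) = 0" by (simp add: algebra_simps power2_eq_square power3_eq_cube)
    with \<open>\<zeta> \<noteq> 1\<close> have \<zeta>2: "\<zeta>\<^sup>2 + \<zeta> + 1 = 0" by simp
    have "1 + 2 * \<zeta> - \<zeta> * (1 - \<zeta>) = \<zeta>\<^sup>2 + \<zeta> + 1"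
      "2 + \<zeta> - (1 - \<zeta>\<^sup>2) = \<zeta>\<^sup>2 + \<zeta> + 1"
      by (simp_all add: algebra_simps power2_eq_square)
    then have factor: "1 + 2 * \<zeta> = \<zeta> * (1 - \<zeta>)" "2 + \<zeta> = 1 - \<zeta>\<^sup>2" by (simp_all only: \<zeta>2 right_minus_eq)
    have "\<zeta>\<^sup>2 \<noteq> 1"
    proof
      assume "\<zeta>\<^sup>2 = 1"
      then have "\<zeta> ^ 3 = \<zeta>" by (simp add: power2_eq_square power3_eq_cube)
      with \<zeta>_cube \<open>\<zeta> \<noteq> 1\<close> show False by simp
    qed
    moreover have "\<zeta> \<noteq> 0" using \<zeta>2 by auto
    ultimately have nz: "1 + 2 * \<zeta> \<noteq> 0" "2 + \<zeta> \<noteq> 0"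
      using \<open>\<zeta> \<noteq> 1\<close> unfolding factor by auto
    define g1 where "g1 x = x + \<zeta> * (\<sigma> x + \<sigma> (\<sigma> x))" for x
    define g3 where "g3 x = - (\<zeta> * x + \<sigma> x + \<sigma> (\<sigma> x))" for x
    have add: "additive g1" "additive g3" by (auto simp: additive_def g1_def g3_def \<sigma> algebra_simps)
    have g1_0: "x = 0" if "g1 x = 0" for x
    proof -
      \<comment> \<open>the kernel lies in the base field, where \<open>g1\<close> is multiplication by \<open>1 + 2 * \<zeta>\<close>\<close>
      have "(1 - \<zeta>) * (x - \<sigma> x) = g1 x - \<sigma> (g1 x)"
        by (simp add: g1_def \<sigma> \<sigma>3 \<sigma>\<zeta> algebra_simps)
      also have "\<dots> = 0" using that \<sigma> by simp
      finally have "\<sigma> x = x" using \<open>\<zeta> \<noteq> 1\<close> by simp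
      then have "(1 + 2 * \<zeta>) * x = 0" using that by (simp add: g1_def algebra_simps)
      then show ?thesis using nz by simp
    qed
    have g3_0: "x = 0" if "g3 x = 0" for x
    proof -
      \<comment> \<open>likewise, and on the base field \<open>g3\<close> is multiplication by \<open>- (2 + \<zeta>)\<close>\<close>
      have "(1 - \<zeta>) * (x - \<sigma> x) = g3 x - \<sigma> (g3 x)"
        by (simp add: g3_def \<sigma> \<sigma>3 \<sigma>\<zeta> algebra_simps)
      also have "\<dots> = 0" using that \<sigma> by simp
      finally have "\<sigma> x = x" using \<open>\<zeta> \<noteq> 1\<close> by simp
      then have "(2 + \<zeta>) * x = - g3 x" by (simp add: g3_def algebra_simps)
      then have "(2 + \<zeta>) * x = 0" using that by simp
      then show ?thesis using nz by simp
    qed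
    \<comment> \<open>scaling by \<open>\<mu>\<close> replaces \<open>v\<close> by \<open>v * N(\<mu>) / (\<sigma> (\<sigma> \<mu>)) ^ 3\<close>, with \<open>N\<close> the norm;
      as \<open>v = w ^ 3\<close>, this is \<open>\<zeta> = N(w)\<close> when \<open>\<sigma> (\<sigma> \<mu>) = w\<close>\<close>
    define \<mu> where "\<mu> = \<sigma> w"
    have nz': "\<mu> \<noteq> 0" using w0 \<sigma>0 by (simp add: \<mu>_def)
    have "isotopic star (\<lambda>x y :: 'a. x ^ (q ^ 1) * y + x * y ^ (q ^ 1))"
    proof (rule isotopicI[of "\<lambda>x. g1 (\<mu> * x)" "\<lambda>x. g1 (\<mu> * x)" "\<lambda>z. g3 (\<mu> * \<sigma> \<mu> * z)"])
      show "additive (\<lambda>x. g1 (\<mu> * x))" "additive (\<lambda>x. g1 (\<mu> * x))"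
        "additive (\<lambda>z. g3 (\<mu> * \<sigma> \<mu> * z))"
        using add by (auto simp: additive_def distrib_left)
      show "x = 0" if "g1 (\<mu> * x) = 0" for x using g1_0[OF that] nz' by simp
      show "x = 0" if "g1 (\<mu> * x) = 0" for x using g1_0[OF that] nz' by simp
      show "x = 0" if "g3 (\<mu> * \<sigma> \<mu> * x) = 0" for x using g3_0[OF that] nz' \<sigma>0 by simp
      show "g1 (\<mu> * x) ^ (q ^ 1) * g1 (\<mu> * y) + g1 (\<mu> * x) * g1 (\<mu> * y) ^ (q ^ 1) =
         g3 (\<mu> * \<sigma> \<mu> * star x y)" for x y
      proof -
        define X where "X = \<mu> * x"
        define Y where "Y = \<mu> * y"
        have "\<mu> * \<sigma> \<mu> * star x y = X * \<sigma> Y + \<sigma> X * Y - 2 * \<zeta> * (\<sigma> (\<sigma> X) * \<sigma> (\<sigma> Y))"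
          by (simp add: star X_def Y_def \<sigma> \<sigma>3 v \<zeta>_def \<mu>_def power3_eq_cube algebra_simps)
        then show ?thesis
          using cubic_twisted_identity[OF \<zeta>2, of "\<sigma> X" "\<sigma> (\<sigma> X)" X Y "\<sigma> Y" "\<sigma> (\<sigma> Y)"]
          by (simp add: g1_def g3_def \<sigma> \<sigma>3 \<sigma>\<zeta> pow flip: X_def Y_def)
      qed
    qed
    then show ?thesis using gtf[of 1] by blast
  qed
qed

section \<open>Comparison with the known families\<close>

lemma zkw_not_isotopic_low_rank:
  fixes star :: "'a::{field, finite} \<Rightarrow> 'a \<Rightarrow> 'a"
    and star' :: "'t::{finite, ab_group_add} \<Rightarrow> 't \<Rightarrow> 't"
  assumes zkw: "zha_kyureghyan_wang q h star" "h > 1"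
    and star': "has_component_of_rank TYPE('b::{field, finite}) 3 star'" "CARD('t) = CARD('b) ^ j"
  shows "\<not> isotopic star star'"
proof
  assume iso: "isotopic star star'"
  have "odd_prime_power q" and card: "CARD('a) = q ^ (3 * h)"
    using zkw(1) by (auto simp: zha_kyureghyan_wang_def)
  then obtain p a where p: "prime p" "q = p ^ a" by (auto elim: odd_prime_powerE)
  have "CARD('a) = p ^ (a * (3 * h))" using card p by (simp add: power_mult)
  moreover have "CARD('a) = CARD('b) ^ j" using isotopic_card[OF iso] star'(2) by simp
  ultimately obtain e :: "'b \<Rightarrow> 'a" where
    "additive e" "\<And>x y. e (x * y) = e x * e y" "\<And>x. e x = 0 \<longleftrightarrow> x = 0"
    using finite_field_embedding[OF p(1)] by blast
  from isotopic_component_of_rank[OF iso star'(1) this] zkw_component_rank[OF zkw]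
  show False by simp
qed

lemma zkw_not_isotopic_coulter_henderson_kosick:
  fixes star :: "'a::{field, finite} \<Rightarrow> 'a \<Rightarrow> 'a" and star' :: "'b::{field, finite} \<Rightarrow> 'b \<Rightarrow> 'b"
  assumes "zha_kyureghyan_wang q h star" "coulter_henderson_kosick star'"
  shows "\<not> isotopic star star'"
proof
  assume "isotopic star star'"
  then have "CARD('a) = 3 ^ 8"
    using isotopic_card assms(2) unfolding coulter_henderson_kosick_def by metis
  moreover have "odd_prime_power q" "CARD('a) = q ^ (3 * h)" "odd h"
    using assms(1) by (auto simp: zha_kyureghyan_wang_def)
  moreover from this obtain p a where p: "prime p" "a > 0" "q = p ^ a" by (auto elim: odd_prime_powerE)
  ultimately have "p ^ (a * (3 * h)) = 3 ^ 8" "a * (3 * h) > 0"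
    by (auto simp: power_mult odd_pos)
  from prime_power_inj'(2)[OF p(1) _ this] have "a * (3 * h) = 8" by simp
  then have "3 dvd (8 :: nat)" by (metis dvd_triv_left mult.left_commute)
  then show False by simp
qed

text \<open>
  The arithmetic conditions of the family force \<open>n\<close> to be even and \<open>m\<close> to be odd.  So \<open>m = 1\<close> leads to the
  degenerate case \<open>n = 2\<close>, which has only three monomials, and for \<open>m > 1\<close> the middle nuclei
  can be compared.
\<close>

lemma zkw_not_isotopic_bierbrauer:
  fixes star :: "'a::{field, finite} \<Rightarrow> 'a \<Rightarrow> 'a" and star' :: "'b::{field, finite} \<Rightarrow> 'b \<Rightarrow> 'b"
  assumes zkw: "zha_kyureghyan_wang q h star" "h > 1" and "bierbrauer star'"
  shows "\<not> isotopic star star'"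
proof -
  from assms(3) obtain r m n u v where b: "odd_prime_power r" "CARD('b) = r ^ (4 * m)"
    "primitive_element u" "v = u ^ (r ^ m - 1)" "0 < n" "n < 4 * m" "coprime m n"
    "odd ((2 * m) div gcd (2 * m) n)"
    "star' = (\<lambda>x y. y ^ (r ^ n) * x + y * x ^ (r ^ n)
                  - v * (y ^ (r ^ (m + n)) * x ^ (r ^ (3 * m))
                         + y ^ (r ^ (3 * m)) * x ^ (r ^ (m + n))))"
    unfolding bierbrauer_def by blast
  have n: "even n"
  proof (rule ccontr)
    assume "odd n"
    then have "gcd (2 * m) n = 1" using b(7) by simp
    then show False using b(8) by simp
  qed
  have m: "odd m" using b(7) n by (metis coprime_common_divisor_nat dvd_refl even_numeral nat_dvd_1_iff_1 numeral_eq_one_iff odd_one)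
  have "m > 0" using b(6) by simp
  show ?thesis
  proof (cases "m = 1")
    case True
    then have "n = 2" using b(5,6) n by (auto elim!: evenE)
    then have "star' = (\<lambda>x y. y ^ (r ^ 2) * x + y * x ^ (r ^ 2)
                  - v * (y ^ (r ^ 3) * x ^ (r ^ 3) + y ^ (r ^ 3) * x ^ (r ^ 3)))"
      using True b(9) by (simp only: one_plus_numeral mult_1_right add_One) simp
    from bierbrauer_degree_one_component[OF this] show ?thesis
      by (rule zkw_not_isotopic_low_rank[OF zkw, where j=1]) simp
  next
    case False
    with \<open>m > 0\<close> have "m > 1" by simp
    from zkw(1) obtain n' u' v' where z: "odd_prime_power q" "odd h" "CARD('a) = q ^ (3 * h)"
      "coprime h n'" "primitive_element u'" "v' = u' ^ (q ^ h - 1)"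
      "star = (\<lambda>x y. y ^ (q ^ n') * x + y * x ^ (q ^ n')
                    - v' * (y ^ (q ^ (h + n')) * x ^ (q ^ (2 * h))
                           + y ^ (q ^ (2 * h)) * x ^ (q ^ (h + n'))))"
      unfolding zha_kyureghyan_wang_def by blast
    have "card (middle_nucleus star) = q ^ (2 - 1)"
      by (rule four_term_middle_nucleus[where m=h and n=n' and v=v'])
         (use z zkw(2) primitive_element_nonzero[OF z(5)] in simp_all)
    moreover have "card (middle_nucleus star') = r ^ (3 - 1)"
      by (rule four_term_middle_nucleus[where m=m and n=n and v=v])
         (use b n m \<open>m > 1\<close> primitive_element_nonzero[OF b(3)] in simp_all)
    ultimately have nuclei: "q = r ^ 2" if "isotopic star star'"
      using isotopic_card_middle_nucleus[OF that] by simp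
    show ?thesis
    proof
      assume iso: "isotopic star star'"
      have "r ^ (2 * (3 * h)) = r ^ (4 * m)"
        using isotopic_card[OF iso] z(3) b(2) nuclei[OF iso] by (simp add: power_mult)
      moreover have "r > 1" using b(1) primepow_gt_Suc_0 by (simp add: odd_prime_power_def)
      ultimately have "2 * (3 * h) = 4 * m" by (simp add: power_inject_exp)
      then have "even (3 * h)" by presburger
      then show False using z(2) by simp
    qed
  qed
qed

theorem corollary4p9:
  fixes q :: nat
  assumes "odd_prime_power q"
  shows
    "(\<forall>star :: 'a::{field, finite} \<Rightarrow> 'a \<Rightarrow> 'a.
        zha_kyureghyan_wang q 1 star \<longrightarrow>
        (\<exists>star' :: 'a \<Rightarrow> 'a \<Rightarrow> 'a. generalized_twisted_field star' \<and> isotopic star star'))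
     \<and>
     (\<forall>h. \<forall>star :: 'a \<Rightarrow> 'a \<Rightarrow> 'a.
        q > 3 \<and> h > 1 \<and> odd h \<and> zha_kyureghyan_wang q h star \<longrightarrow>
          (\<forall>star' :: 'b::{field, finite} \<times> 'b \<Rightarrow> 'b \<times> 'b \<Rightarrow> 'b \<times> 'b.
             (dickson star' \<or> ganley star' \<or> cohen_ganley star' \<or>
              penttila_williams_bader_lunardon_pinneri star') \<longrightarrow> \<not> isotopic star star')
          \<and>
          (\<forall>star' :: 'b \<Rightarrow> 'b \<Rightarrow> 'b.
             (generalized_twisted_field star' \<or> coulter_matthews_ding_yuan star' \<or>
              coulter_henderson_kosick star' \<or> bierbrauer star' \<or>
              budaghyan_helleseth star' \<or> P_semifield star') \<longrightarrow> \<not> isotopic star star'))"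
proof (rule conjI; intro allI impI)
  fix star :: "'a \<Rightarrow> 'a \<Rightarrow> 'a"
  assume "zha_kyureghyan_wang q 1 star"
  then show "\<exists>star' :: 'a \<Rightarrow> 'a \<Rightarrow> 'a. generalized_twisted_field star' \<and> isotopic star star'"
    by (rule zkw_cubic_isotopic_twisted_field)
next
  fix h and star :: "'a \<Rightarrow> 'a \<Rightarrow> 'a"
  assume "q > 3 \<and> h > 1 \<and> odd h \<and> zha_kyureghyan_wang q h star"
  then have zkw: "zha_kyureghyan_wang q h star" "h > 1" by auto
  show "(\<forall>star' :: 'b \<times> 'b \<Rightarrow> 'b \<times> 'b \<Rightarrow> 'b \<times> 'b.
             (dickson star' \<or> ganley star' \<or> cohen_ganley star' \<or>
              penttila_williams_bader_lunardon_pinneri star') \<longrightarrow> \<not> isotopic star star')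
          \<and>
          (\<forall>star' :: 'b \<Rightarrow> 'b \<Rightarrow> 'b.
             (generalized_twisted_field star' \<or> coulter_matthews_ding_yuan star' \<or>
              coulter_henderson_kosick star' \<or> bierbrauer star' \<or>
              budaghyan_helleseth star' \<or> P_semifield star') \<longrightarrow> \<not> isotopic star star')"
  proof (rule conjI; intro allI impI)
    fix star' :: "'b \<times> 'b \<Rightarrow> 'b \<times> 'b \<Rightarrow> 'b \<times> 'b"
    assume "dickson star' \<or> ganley star' \<or> cohen_ganley star' \<or>
              penttila_williams_bader_lunardon_pinneri star'"
    then show "\<not> isotopic star star'"
      by (intro zkw_not_isotopic_low_rank[OF zkw pair_families_component, of _ 2])
         (simp_all add: power2_eq_square)
  next
    fix star' :: "'b \<Rightarrow> 'b \<Rightarrow> 'b"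
    assume "generalized_twisted_field star' \<or> coulter_matthews_ding_yuan star' \<or>
              coulter_henderson_kosick star' \<or> bierbrauer star' \<or>
              budaghyan_helleseth star' \<or> P_semifield star'"
    then consider "has_component_of_rank TYPE('b) 3 star'" | "coulter_henderson_kosick star'"
      | "bierbrauer star'"
      using generalized_twisted_field_component coulter_matthews_ding_yuan_component budaghyan_helleseth_component P_semifield_component by blast
    then show "\<not> isotopic star star'"
    proof cases
      case 1
      then show ?thesis by (rule zkw_not_isotopic_low_rank[OF zkw, where j=1]) simp
    qed (use zkw zkw_not_isotopic_coulter_henderson_kosick zkw_not_isotopic_bierbrauer in blast)+
  qed
qed

end
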